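(* Consider the integral (mild) equation $$v(x,t)=e^{-A(t)}\,U^{D}(t,0)\varphi(x)+\int_0^t e^{-N_s-A(t,s)}\,U^{D}(t,s)\big[g(e^{N_s}v(\cdot,s))\big](x)\,ds,\qquad x\in D,\ t\ge 0,$$ where $g:\mathbb{R}\to[0,\infty)$ is locally Lipschitz and $\varphi\in L^\infty(D)$, $\varphi\ge 0$. This equation has a unique non-negative local mild solution; i.e., $\mathbb{P}$-a.s. there exists $t>0$ (possibly depending on $\omega$) such that the equation has a (unique non-negative) mild solution in $L^\infty([0,t[\times D)$.
   Context: $D\subset\mathbb{R}^d$ is a bounded Lipschitz domain. $L$ is the infinitesimal generator of a strongly continuous semigroup of contractions $(P^D_t)_{t\ge0}$ on $L^2(D)$, with associated transition functions admitting continuous densities $p^D(t,x,y)$, $t>0$, $x,y\in D$: $P^D_tf(x)=\int_D p^D(t,x,y)f(y)\,dy$. On a filtered probability space $(\Omega,\mathcal F,(\mathcal F_t)_{t\ge0},\mathbb P)$, $B$ is a Brownian motion and $B^H$ a fractional Brownian motion with Hurst parameter $H\in(1/2,1)$, both adapted to $(\mathcal F_t)$. The function $a:[0,\infty)\to\mathbb{R}$ is continuous, $b:[0,\infty)\to\mathbb{R}$ is Hölder continuous of order $\alpha>1-H$, and $$N_t=\int_0^t a(s)\,dB_s+\int_0^t b(s)\,dB^H_s ,$$ the first integral being an Itô integral and the second a fractional (generalized Riemann–Stieltjes) integral. The function $k:[0,\infty)\to\mathbb{R}$ is such that $\int_0^t k^2(r)\,dr<\infty$ for all $t$. For $0\le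 s<t$: $K(t,s)=\frac12\int_s^t k^2(r)\,dr$, $A(t,s)=\frac12\int_s^t a^2(r)\,dr$, $A(t)=A(t,0)$, and $U^D(t,s)f(x)=P^D_{K(t,s)}f(x)=\int_D p^D(K(t,s),x,y)f(y)\,dy$. The displayed equation is the mild form of the random partial differential equation $$\frac{\partial v}{\partial t}(x,t)=\tfrac12k^2(t)Lv(x,t)-\tfrac12a^2(t)v(x,t)+e^{-N_t}g(e^{N_t}v(x,t)),\quad v(x,0)=\varphi(x)\ (x\in D),\quad v(x,t)=0\ (x\in\partial D,\ t\ge0).$$ *)

theory Defs
  imports "HOL-Probability.Probability"
begin

definition bounded_lipschitz_domain :: "'a::euclidean_space set \<Rightarrow> bool" where
  "bounded_lipschitz_domain D \<longleftrightarrow>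
     D \<noteq> {} \<and> open D \<and> connected D \<and> bounded D \<and>
     (\<forall>q\<in>frontier D. \<exists>r>0. \<exists>e h C. norm e = 1 \<and> C-lipschitz_on {z. z \<bullet> e = 0} h \<and>
        D \<inter> ball q r = {x \<in> ball q r. x \<bullet> e > h (x - (x \<bullet> e) *\<^sub>R e)})"

text \<open>Elements of the Lebesgue spaces over \<open>S\<close> are given by Borel representatives, whose values
  outside \<open>S\<close> are irrelevant; equality in these spaces is almost everywhere equality on \<open>S\<close>.\<close>

definition L2_on :: "'a::euclidean_space set \<Rightarrow> ('a \<Rightarrow> real) \<Rightarrow> bool" where
  "L2_on S f \<longleftrightarrow> set_borel_measurable lborel S f \<and> set_integrable lborel S (\<lambda>x. (f x)\<^sup>2)"

definition L2_norm_on :: "'a::euclidean_space set \<Rightarrow> ('a \<Rightarrow> real) \<Rightarrow> real" where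
  "L2_norm_on S f = sqrt (LINT x:S|lborel. (f x)\<^sup>2)"

definition Linf_on :: "'a::euclidean_space set \<Rightarrow> ('a \<Rightarrow> real) \<Rightarrow> bool" where
  "Linf_on S f \<longleftrightarrow> set_borel_measurable lborel S f \<and>
     (\<exists>C. AE x in lborel. x \<in> S \<longrightarrow> \<bar>f x\<bar> \<le> C)"

text \<open>Linearity and contractivity make \<open>P t\<close> respect almost everywhere equality on \<open>D\<close>.\<close>

definition contraction_semigroup_L2 ::
  "'a::euclidean_space set \<Rightarrow> (real \<Rightarrow> ('a \<Rightarrow> real) \<Rightarrow> 'a \<Rightarrow> real) \<Rightarrow> bool" where
  "contraction_semigroup_L2 D P \<longleftrightarrow>
     (\<forall>t\<ge>0. \<forall>f. L2_on D f \<longrightarrow> L2_on D (P t f) \<and> L2_norm_on D (P t f) \<le> L2_norm_on D f) \<and>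
     (\<forall>t\<ge>0. \<forall>f h c d. L2_on D f \<longrightarrow> L2_on D h \<longrightarrow>
        (AE x in lborel. x \<in> D \<longrightarrow> P t (\<lambda>y. c * f y + d * h y) x = c * P t f x + d * P t h x)) \<and>
     (\<forall>f. L2_on D f \<longrightarrow> (AE x in lborel. x \<in> D \<longrightarrow> P 0 f x = f x)) \<and>
     (\<forall>s\<ge>0. \<forall>t\<ge>0. \<forall>f. L2_on D f \<longrightarrow>
        (AE x in lborel. x \<in> D \<longrightarrow> P (s + t) f x = P s (P t f) x)) \<and>
     (\<forall>f. L2_on D f \<longrightarrow> ((\<lambda>t. L2_norm_on D (\<lambda>x. P t f x - f x)) \<longlongrightarrow> 0) (at_right 0))"

text \<open>The graph of the generator.\<close>

definition L2_generator ::
  "'a::euclidean_space set \<Rightarrow> (real \<Rightarrow> ('a \<Rightarrow> real) \<Rightarrow> 'a \<Rightarrow> real) \<Rightarrow> (('a \<Rightarrow> real) \<times> ('a \<Rightarrow> real)) set"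
  where
  "L2_generator D P = {(f, h). L2_on D f \<and> L2_on D h \<and>
     ((\<lambda>t. L2_norm_on D (\<lambda>x. (P t f x - f x) / t - h x)) \<longlongrightarrow> 0) (at_right 0)}"

text \<open>Transition functions are sub-Markovian kernels: killing at the boundary of \<open>D\<close> may destroy
  mass.\<close>

definition continuous_transition_density ::
  "'a::euclidean_space set \<Rightarrow> (real \<Rightarrow> ('a \<Rightarrow> real) \<Rightarrow> 'a \<Rightarrow> real) \<Rightarrow> (real \<Rightarrow> 'a \<Rightarrow> 'a \<Rightarrow> real) \<Rightarrow> bool"
  where
  "continuous_transition_density D P p \<longleftrightarrow>
     continuous_on ({0<..} \<times> D \<times> D) (\<lambda>(t, x, y). p t x y) \<and>
     (\<forall>t>0. \<forall>x\<in>D. \<forall>y\<in>D. 0 \<le> p t x y) \<and>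
     (\<forall>t>0. \<forall>x\<in>D. (\<integral>\<^sup>+y\<in>D. ennreal (p t x y) \<partial>lborel) \<le> 1) \<and>
     (\<forall>t>0. \<forall>f. L2_on D f \<longrightarrow>
        (AE x in lborel. x \<in> D \<longrightarrow> P t f x = (LINT y:D|lborel. p t x y * f y)))"

text \<open>All processes are indexed by \<open>t \<ge> 0\<close>; values at negative times are irrelevant. A filtration
  on \<open>[0, \<infinity>)\<close> extends to the index type \<^typ>\<open>real\<close> by \<open>F t = F 0\<close> for \<open>t < 0\<close>.\<close>

definition filtered_prob_space :: "'w measure \<Rightarrow> (real \<Rightarrow> 'w measure) \<Rightarrow> bool" where
  "filtered_prob_space M F \<longleftrightarrow>
     prob_space M \<and> filtration (space M) F \<and> (\<forall>t. subalgebra M (F t))"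

definition adapted :: "(real \<Rightarrow> 'w measure) \<Rightarrow> (real \<Rightarrow> 'w \<Rightarrow> real) \<Rightarrow> bool" where
  "adapted F X \<longleftrightarrow> (\<forall>t\<ge>0. X t \<in> borel_measurable (F t))"

definition continuous_paths :: "'w measure \<Rightarrow> (real \<Rightarrow> 'w \<Rightarrow> real) \<Rightarrow> bool" where
  "continuous_paths M X \<longleftrightarrow> (AE \<omega> in M. continuous_on {0..} (\<lambda>t. X t \<omega>))"

definition brownian_motion ::
  "'w measure \<Rightarrow> (real \<Rightarrow> 'w measure) \<Rightarrow> (real \<Rightarrow> 'w \<Rightarrow> real) \<Rightarrow> bool" where
  "brownian_motion M F B \<longleftrightarrow>
     adapted F B \<and> continuous_paths M B \<and> (AE \<omega> in M. B 0 \<omega> = 0) \<and>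
     (\<forall>s\<ge>0. \<forall>t>s.
        distributed M lborel (\<lambda>\<omega>. B t \<omega> - B s \<omega>) (normal_density 0 (sqrt (t - s))) \<and>
        prob_space.indep_set M (sets (F s))
          {(\<lambda>\<omega>. B t \<omega> - B s \<omega>) -` S \<inter> space M | S. S \<in> sets borel})"

definition gaussian_rv :: "'w measure \<Rightarrow> ('w \<Rightarrow> real) \<Rightarrow> bool" where
  "gaussian_rv M X \<longleftrightarrow> X \<in> borel_measurable M \<and>
     ((\<exists>\<mu> \<sigma>. \<sigma> > 0 \<and> distributed M lborel X (normal_density \<mu> \<sigma>)) \<or> (\<exists>\<mu>. AE \<omega> in M. X \<omega> = \<mu>))"

definition gaussian_process :: "'w measure \<Rightarrow> (real \<Rightarrow> 'w \<Rightarrow> real) \<Rightarrow> bool" where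
  "gaussian_process M X \<longleftrightarrow>
     (\<forall>I c. finite I \<longrightarrow> I \<subseteq> {0..} \<longrightarrow> gaussian_rv M (\<lambda>\<omega>. \<Sum>t\<in>I. c t * X t \<omega>))"

definition fractional_brownian_motion ::
  "'w measure \<Rightarrow> real \<Rightarrow> (real \<Rightarrow> 'w \<Rightarrow> real) \<Rightarrow> bool" where
  "fractional_brownian_motion M H W \<longleftrightarrow>
     gaussian_process M W \<and> continuous_paths M W \<and>
     (\<forall>t\<ge>0. (LINT \<omega>|M. W t \<omega>) = 0) \<and>
     (\<forall>s\<ge>0. \<forall>t\<ge>0. (LINT \<omega>|M. W s \<omega> * W t \<omega>) =
        (1/2) * (t powr (2 * H) + s powr (2 * H) - \<bar>t - s\<bar> powr (2 * H)))"

definition simple_integrand ::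
  "'w measure \<Rightarrow> (real \<Rightarrow> 'w measure) \<Rightarrow> nat \<Rightarrow> (nat \<Rightarrow> real) \<Rightarrow> (nat \<Rightarrow> 'w \<Rightarrow> real) \<Rightarrow> bool" where
  "simple_integrand M F n \<tau> \<xi> \<longleftrightarrow>
     0 \<le> \<tau> 0 \<and> (\<forall>i<n. \<tau> i \<le> \<tau> (Suc i)) \<and>
     (\<forall>i<n. \<xi> i \<in> borel_measurable (F (\<tau> i)) \<and> (\<exists>C. \<forall>\<omega>\<in>space M. \<bar>\<xi> i \<omega>\<bar> \<le> C))"

definition simple_process ::
  "nat \<Rightarrow> (nat \<Rightarrow> real) \<Rightarrow> (nat \<Rightarrow> 'w \<Rightarrow> real) \<Rightarrow> real \<Rightarrow> 'w \<Rightarrow> real" where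
  "simple_process n \<tau> \<xi> s \<omega> = (\<Sum>i<n. \<xi> i \<omega> * indicator {\<tau> i<..\<tau> (Suc i)} s)"

definition simple_integral ::
  "(real \<Rightarrow> 'w \<Rightarrow> real) \<Rightarrow> nat \<Rightarrow> (nat \<Rightarrow> real) \<Rightarrow> (nat \<Rightarrow> 'w \<Rightarrow> real) \<Rightarrow> real \<Rightarrow> 'w \<Rightarrow> real" where
  "simple_integral B n \<tau> \<xi> t \<omega> =
     (\<Sum>i<n. \<xi> i \<omega> * (B (min (\<tau> (Suc i)) t) \<omega> - B (min (\<tau> i) t) \<omega>))"

text \<open>\<open>Y\<close> is the continuous version of the process of indefinite integrals of \<open>X\<close> with respect
  to \<open>B\<close>, for \<open>X\<close> square integrable on \<open>\<Omega> \<times> [0, T]\<close> for each \<open>T\<close>. By the isometry property, the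
  limit does not depend on the approximating sequence, so that \<open>Y\<close> is determined up to
  indistinguishability.\<close>

definition ito_integral ::
  "'w measure \<Rightarrow> (real \<Rightarrow> 'w measure) \<Rightarrow> (real \<Rightarrow> 'w \<Rightarrow> real) \<Rightarrow> (real \<Rightarrow> 'w \<Rightarrow> real) \<Rightarrow>
   (real \<Rightarrow> 'w \<Rightarrow> real) \<Rightarrow> bool" where
  "ito_integral M F B X Y \<longleftrightarrow>
     (\<forall>t\<ge>0. Y t \<in> borel_measurable M) \<and> continuous_paths M Y \<and>
     (\<forall>T\<ge>0. \<exists>n \<tau> \<xi>. (\<forall>j. simple_integrand M F (n j) (\<tau> j) (\<xi> j)) \<and>
        (\<lambda>j. \<integral>\<^sup>+\<omega>. (\<integral>\<^sup>+s\<in>{0..T}. ennreal ((simple_process (n j) (\<tau> j) (\<xi> j) s \<omega> - X s \<omega>)\<^sup>2)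
               \<partial>lborel) \<partial>M) \<longlonglongrightarrow> 0 \<and>
        (\<forall>t\<in>{0..T}.
           (\<lambda>j. \<integral>\<^sup>+\<omega>. ennreal ((Y t \<omega> - simple_integral B (n j) (\<tau> j) (\<xi> j) t \<omega>)\<^sup>2) \<partial>M)
             \<longlonglongrightarrow> 0))"

text \<open>Weyl--Marchaud fractional derivatives of order \<open>\<gamma> \<in> (0, 1)\<close> on \<open>[0, t]\<close>: the left-sided
  derivative of \<open>f\<close>, and the right-sided derivative of \<open>g - g t\<close> without its customary complex
  factor \<open>(-1)\<^sup>\<gamma>\<close>.\<close>

definition left_frac_deriv :: "real \<Rightarrow> (real \<Rightarrow> real) \<Rightarrow> real \<Rightarrow> real" where
  "left_frac_deriv \<gamma> f x = 1 / Gamma (1 - \<gamma>) *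
     (f x / x powr \<gamma> + \<gamma> * (LINT y:{0..x}|lborel. (f x - f y) / (x - y) powr (\<gamma> + 1)))"

definition right_frac_deriv :: "real \<Rightarrow> real \<Rightarrow> (real \<Rightarrow> real) \<Rightarrow> real \<Rightarrow> real" where
  "right_frac_deriv \<gamma> t g x = 1 / Gamma (1 - \<gamma>) *
     ((g x - g t) / (t - x) powr \<gamma> + \<gamma> * (LINT y:{x..t}|lborel. (g x - g y) / (y - x) powr (\<gamma> + 1)))"

text \<open>Zaehle's generalized Riemann--Stieltjes integral of \<open>f\<close> against a continuous \<open>g\<close> over
  \<open>[0, t]\<close>. The leading sign is \<open>(-1)\<^sup>\<gamma> (-1)\<^sup>1\<^sup>-\<^sup>\<gamma> = -1\<close>. If \<open>f\<close> and \<open>g\<close> are Hoelder continuous of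
  orders greater than \<open>\<gamma>\<close> and \<open>1 - \<gamma>\<close> respectively, the value does not depend on \<open>\<gamma>\<close>.\<close>

definition frac_integral :: "real \<Rightarrow> (real \<Rightarrow> real) \<Rightarrow> (real \<Rightarrow> real) \<Rightarrow> real \<Rightarrow> real" where
  "frac_integral \<gamma> f g t =
     - (LINT x:{0..t}|lborel. left_frac_deriv \<gamma> f x * right_frac_deriv (1 - \<gamma>) t g x)"

definition hoelder_on :: "real \<Rightarrow> real set \<Rightarrow> (real \<Rightarrow> real) \<Rightarrow> bool" where
  "hoelder_on \<alpha> S f \<longleftrightarrow> (\<exists>C. \<forall>s\<in>S. \<forall>t\<in>S. \<bar>f t - f s\<bar> \<le> C * \<bar>t - s\<bar> powr \<alpha>)"

text \<open>\<open>half_energy k t s\<close> and \<open>half_energy a t s\<close> are the functions usually written \<open>K(t,s)\<close> and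
  \<open>A(t,s)\<close>.\<close>

definition half_energy :: "(real \<Rightarrow> real) \<Rightarrow> real \<Rightarrow> real \<Rightarrow> real" where
  "half_energy f t s = (1/2) * (LINT r:{s..t}|lborel. (f r)\<^sup>2)"

text \<open>The first branch is \<open>P 0 = id\<close>; it occurs when \<open>k\<close> vanishes almost everywhere on \<open>[s, t]\<close>.\<close>

definition evol ::
  "'a::euclidean_space set \<Rightarrow> (real \<Rightarrow> 'a \<Rightarrow> 'a \<Rightarrow> real) \<Rightarrow> (real \<Rightarrow> real) \<Rightarrow> real \<Rightarrow> real \<Rightarrow>
   ('a \<Rightarrow> real) \<Rightarrow> 'a \<Rightarrow> real" where
  "evol D p k t s f x =
     (if half_energy k t s = 0 then f x else (LINT y:D|lborel. p (half_energy k t s) x y * f y))"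

text \<open>Right-hand side of the mild equation for one path \<open>n\<close> of the noise.\<close>

definition mild_rhs ::
  "'a::euclidean_space set \<Rightarrow> (real \<Rightarrow> 'a \<Rightarrow> 'a \<Rightarrow> real) \<Rightarrow> (real \<Rightarrow> real) \<Rightarrow> (real \<Rightarrow> real) \<Rightarrow>
   (real \<Rightarrow> real) \<Rightarrow> ('a \<Rightarrow> real) \<Rightarrow> (real \<Rightarrow> real) \<Rightarrow> ('a \<Rightarrow> real \<Rightarrow> real) \<Rightarrow> 'a \<Rightarrow> real \<Rightarrow> real" where
  "mild_rhs D p k a g \<phi> n v x t =
     exp (- half_energy a t 0) * evol D p k t 0 \<phi> x +
     (LINT s:{0..t}|lborel.
        exp (- n s - half_energy a t s) * evol D p k t s (\<lambda>y. g (exp (n s) * v y s)) x)"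

text \<open>Non-negative solutions in \<open>L\<^sup>\<infinity>([0, T[ \<times> D)\<close>; the equation is an identity in that space.\<close>

definition nonneg_mild_solution ::
  "'a::euclidean_space set \<Rightarrow> (real \<Rightarrow> 'a \<Rightarrow> 'a \<Rightarrow> real) \<Rightarrow> (real \<Rightarrow> real) \<Rightarrow> (real \<Rightarrow> real) \<Rightarrow>
   (real \<Rightarrow> real) \<Rightarrow> ('a \<Rightarrow> real) \<Rightarrow> (real \<Rightarrow> real) \<Rightarrow> real \<Rightarrow> ('a \<Rightarrow> real \<Rightarrow> real) \<Rightarrow> bool" where
  "nonneg_mild_solution D p k a g \<phi> n T v \<longleftrightarrow>
     Linf_on ({0..<T} \<times> D) (\<lambda>(t, x). v x t) \<and>
     (AE (t, x) in lborel. (t, x) \<in> {0..<T} \<times> D \<longrightarrow> 0 \<le> v x t) \<and>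
     (AE (t, x) in lborel. (t, x) \<in> {0..<T} \<times> D \<longrightarrow> v x t = mild_rhs D p k a g \<phi> n v x t)"

end

theory Submission
  imports Defs
begin

text \<open>The equation is solved separately for almost every path \<open>n\<close> of the noise, and all that the
  analysis needs of such a path is that it is Borel measurable and bounded on \<open>[0, 1]\<close>.

  This is where probability enters. The Ito part is continuous by definition. The fractional part is
  a product integral of two Weyl--Marchaud derivatives; it stays bounded as soon as the integrator is
  Hoelder continuous of some order \<open>\<beta> > 1 - \<gamma>\<close>, because then the right-sided derivative of order
  \<open>1 - \<gamma>\<close> is bounded and the left-sided derivative of the integrand has only the integrable
  singularity \<open>x\<^sup>-\<^sup>\<gamma>\<close> at the origin (\<open>frac_integral_bounded\<close>). As \<open>1 - \<gamma> < H\<close>, such an order exists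
  below \<open>H\<close>, and the paths of fractional Brownian motion have it by Kolmogorov's criterion applied to
  high even moments of the Gaussian increments (\<open>fractional_brownian_paths_hoelder\<close>).

  For a fixed path the equation is a fixed point problem for an integral operator on bounded
  measurable functions. The transition density is sub-Markovian, so the evolution does not increase
  the supremum norm; together with the Lipschitz bound for \<open>g\<close> on compact sets this makes the
  operator a contraction by the factor \<open>1/2\<close> in the weighted norm \<open>sup e\<^sup>-\<^sup>\<lambda>\<^sup>t |v(x,t)|\<close> when \<open>\<lambda>\<close> is large
  (\<open>rhs_weighted_contraction\<close>). On a short time interval the operator maps the functions with values in
  \<open>[0, c + 1]\<close> into themselves, where \<open>c\<close> bounds the initial value (\<open>rhs_invariant_box\<close>), and Picard
  iteration converges to a non-negative solution (\<open>nonneg_solution_exists\<close>). The same contraction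
  estimate, with constants adapted to the bounds of two given solutions, forces these to agree
  (\<open>nonneg_solution_unique\<close>).

  Solutions are only determined almost everywhere, but the evolution over \<open>[s, t]\<close> is the identity
  when \<open>k\<close> vanishes there, and then it reads off a value at the single point \<open>x\<close>. The contraction
  estimate therefore takes two forms of smallness as hypotheses: almost everywhere on almost every time
  slice, and at almost all times above the fixed point \<open>x\<close>. Fubini's theorem supplies both from
  smallness almost everywhere in space-time.\<close>

section \<open>Hoelder continuity of fractional Brownian paths\<close>

text \<open>Chaining: every point of \<open>[0, 1]\<close> is the limit of its dyadic lower approximations, whose
  consecutive members are equal or neighbours on the finer grid. At the scale \<open>2\<^sup>-\<^sup>m\<close> comparable to
  \<open>|t - s|\<close> the approximations of \<open>s\<close> and \<open>t\<close> are themselves equal or neighbours, and the increments at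
  the finer scales add up to a geometric series.\<close>

lemma dyadic_increments_imp_hoelder_on:
  fixes X :: "real \<Rightarrow> real"
  assumes cont: "continuous_on {0..1} X" and \<beta>: "0 < \<beta>"
    and incr: "\<And>n k. k < 2 ^ n \<Longrightarrow>
      \<bar>X (real (Suc k) / 2 ^ n) - X (real k / 2 ^ n)\<bar> \<le> C * (2 powr - \<beta>) ^ n"
  shows "hoelder_on \<beta> {0..1} X"
proof -
  define r where "r = 2 powr - \<beta>"
  have r: "0 < r" "r < 1"
    using \<beta> by (auto simp: r_def powr_less_one)
  have C: "0 \<le> C"
    using incr[of 0 0] by simp
  \<comment> \<open>\<open>d n u\<close> is the largest multiple of \<open>2\<^sup>-\<^sup>n\<close> that is at most \<open>u\<close>.\<close>
  define q where "q n u = nat \<lfloor>2 ^ n * u\<rfloor>" for n :: nat and u :: real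
  define d where "d n u = real (q n u) / 2 ^ n" for n u
  have q_le: "real (q n u) \<le> 2 ^ n * u" and q_gt: "2 ^ n * u < real (q n u) + 1"
    if "0 \<le> u" for n u
    using that by (simp_all add: q_def)
  have d01: "d n u \<in> {0..1}" if "u \<in> {0..1}" for n u
  proof -
    have "d n u \<le> u"
      using q_le[of u n] that by (simp add: d_def field_simps)
    moreover have "0 \<le> d n u"
      by (simp add: d_def)
    ultimately show ?thesis
      using that by simp
  qed
  have d_lim: "(\<lambda>n. d n u) \<longlonglongrightarrow> u" if "u \<in> {0..1}" for u
  proof (rule tendsto_sandwich)
    show "\<forall>\<^sub>F n in sequentially. u - (1/2) ^ n \<le> d n u"
    proof (intro always_eventually allI)
      fix n
      have "2 ^ n * u \<le> real (q n u) + 1"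
        using q_gt[of u n] that by simp
      then have "u \<le> (real (q n u) + 1) / 2 ^ n"
        by (simp add: pos_le_divide_eq mult.commute)
      then show "u - (1/2) ^ n \<le> d n u"
        by (simp add: d_def add_divide_distrib power_divide)
    qed
    show "\<forall>\<^sub>F n in sequentially. d n u \<le> u"
      using q_le[of u] that by (intro always_eventually allI) (simp add: d_def field_simps)
    have "(\<lambda>n. u - (1/2) ^ n) \<longlonglongrightarrow> u - 0"
      by (intro tendsto_diff tendsto_const LIMSEQ_power_zero) simp
    then show "(\<lambda>n. u - (1/2) ^ n) \<longlonglongrightarrow> u"
      by simp
  qed simp
  have neighbours: "\<bar>X (real j / 2 ^ n) - X (real i / 2 ^ n)\<bar> \<le> C * r ^ n"
    if "i \<le> j" "j \<le> i + 1" "j \<le> 2 ^ n" for i j n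
  proof (cases "i = j")
    case True
    then show ?thesis using C r by simp
  next
    case False
    then have "j = Suc i" using that by simp
    then show ?thesis using incr[of i n] that by (simp add: r_def)
  qed
  have q_top: "q n u \<le> 2 ^ n" if "u \<in> {0..1}" for n u
  proof -
    have "real (q n u) \<le> 2 ^ n * u" using that by (intro q_le) simp
    also have "\<dots> \<le> 2 ^ n" using that by simp
    finally have "real (q n u) \<le> real (2 ^ n)" by simp
    then show ?thesis by (simp only: of_nat_le_iff)
  qed
  have refine: "\<bar>X (d (Suc n) u) - X (d n u)\<bar> \<le> C * r ^ Suc n" if u: "u \<in> {0..1}" for n u
  proof -
    have u0: "0 \<le> u" using u by simp
    have "real (2 * q n u) < real (q (Suc n) u + 1)"
      using q_le[OF u0, of n] q_gt[OF u0, of "Suc n"] by simp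
    moreover have "real (q (Suc n) u) < real (2 * q n u + 2)"
      using q_gt[OF u0, of n] q_le[OF u0, of "Suc n"] by simp
    ultimately have "2 * q n u \<le> q (Suc n) u" "q (Suc n) u \<le> 2 * q n u + 1"
      by linarith+
    then have "\<bar>X (real (q (Suc n) u) / 2 ^ Suc n) - X (real (2 * q n u) / 2 ^ Suc n)\<bar>
        \<le> C * r ^ Suc n"
      using q_top[OF u, of "Suc n"] by (intro neighbours)
    then show ?thesis by (simp add: d_def)
  qed
  have tail: "\<bar>X u - X (d m u)\<bar> \<le> C * r ^ m / (1 - r)" if u: "u \<in> {0..1}" for m u
  proof -
    have partial: "\<bar>X (d (m + j) u) - X (d m u)\<bar> \<le> C * r ^ m / (1 - r) * (1 - r ^ j)" for j
    proof (induction j)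
      case (Suc j)
      have "\<bar>X (d (m + Suc j) u) - X (d m u)\<bar>
          \<le> C * r ^ Suc (m + j) + C * r ^ m / (1 - r) * (1 - r ^ j)"
        using refine[OF u, of "m + j"] Suc.IH by simp
      also have "\<dots> \<le> C * r ^ (m + j) + C * r ^ m / (1 - r) * (1 - r ^ j)"
        using C r by (simp add: mult_left_mono mult_left_le_one_le)
      also have "\<dots> = C * r ^ m / (1 - r) * (1 - r ^ Suc j)"
        using r by (simp add: field_simps power_add)
      finally show ?case .
    qed simp
    have "\<bar>X (d (m + j) u) - X (d m u)\<bar> \<le> C * r ^ m / (1 - r)" for j
    proof -
      have "C * r ^ m / (1 - r) * (1 - r ^ j) \<le> C * r ^ m / (1 - r) * 1"
        using C r by (intro mult_left_mono) auto
      then show ?thesis using partial[of j] by simp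
    qed
    moreover have "(\<lambda>j. X (d (m + j) u)) \<longlonglongrightarrow> X u"
    proof -
      have "(\<lambda>n. X (d n u)) \<longlonglongrightarrow> X u"
        using continuous_on_tendsto_compose[OF cont d_lim[OF u] u] d01[OF u] by simp
      from LIMSEQ_ignore_initial_segment[OF this, of m] show ?thesis
        by (simp add: add.commute)
    qed
    then have "(\<lambda>j. \<bar>X (d (m + j) u) - X (d m u)\<bar>) \<longlonglongrightarrow> \<bar>X u - X (d m u)\<bar>"
      by (intro tendsto_intros)
    ultimately show ?thesis
      by (intro LIMSEQ_le_const2) auto
  qed
  define C' where "C' = C * (1 + 2 / (1 - r)) / r"
  have main: "\<bar>X t - X s\<bar> \<le> C' * \<bar>t - s\<bar> powr \<beta>" if st: "s \<in> {0..1}" "t \<in> {0..1}" "s < t" for s t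
  proof -
    \<comment> \<open>\<open>m\<close> is the scale with \<open>2\<^sup>-\<^sup>m\<^sup>-\<^sup>1 < t - s \<le> 2\<^sup>-\<^sup>m\<close>.\<close>
    have "\<exists>n. (1/2::real) ^ n < t - s"
      using st by (intro real_arch_pow_inv) auto
    then have "\<exists>n. (1/2::real) ^ n < t - s \<and> (\<forall>i<n. \<not> (1/2::real) ^ i < t - s)"
      by (rule exists_least_iff[THEN iffD1])
    then obtain n where n: "(1/2::real) ^ n < t - s"
      and least: "\<And>i. i < n \<Longrightarrow> \<not> (1/2::real) ^ i < t - s"
      by blast
    have "n \<noteq> 0"
      using n st by (cases n) auto
    then obtain m where m: "n = Suc m"
      using not0_implies_Suc by blast
    have up: "t - s \<le> (1/2) ^ m" and low: "(1/2) ^ Suc m < t - s"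
      using least[of m] n m by auto
    have s0: "0 \<le> s" "0 \<le> t" using st by auto
    have diff: "2 ^ m * t - 2 ^ m * s \<le> 1"
      using up by (simp add: field_simps power_divide)
    have "q m s \<le> q m t"
      using st by (auto simp: q_def intro!: nat_mono floor_mono)
    moreover have "real (q m t) < real (q m s + 2)"
      using diff q_le[OF s0(2), of m] q_gt[OF s0(1), of m] by simp
    ultimately have "\<bar>X (d m t) - X (d m s)\<bar> \<le> C * r ^ m"
      using q_top[OF st(2)] unfolding d_def by (intro neighbours) linarith+
    then have "\<bar>X t - X s\<bar> \<le> C * r ^ m + 2 * (C * r ^ m / (1 - r))"
      using tail[OF st(1), of m] tail[OF st(2), of m] by linarith
    also have "\<dots> = C' * r ^ Suc m"
      using r by (simp add: C'_def field_simps)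
    also have "\<dots> \<le> C' * \<bar>t - s\<bar> powr \<beta>"
    proof (rule mult_left_mono)
      have "r ^ Suc m = ((1/2) ^ Suc m) powr \<beta>"
        unfolding r_def by (simp add: powr_realpow[symmetric] powr_powr powr_divide powr_minus_divide mult.commute del: power_Suc)
      also have "\<dots> \<le> (t - s) powr \<beta>"
        using low \<beta> by (intro powr_mono2) auto
      finally show "r ^ Suc m \<le> \<bar>t - s\<bar> powr \<beta>"
        using st by simp
      show "0 \<le> C'" using C r by (simp add: C'_def)
    qed
    finally show ?thesis .
  qed
  show ?thesis
    unfolding hoelder_on_def
  proof (intro exI ballI)
    fix s t :: real assume st: "s \<in> {0..1}" "t \<in> {0..1}"
    consider "s < t" | "t < s" | "s = t" by linarith
    then show "\<bar>X t - X s\<bar> \<le> C' * \<bar>t - s\<bar> powr \<beta>"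
    proof cases
      case 1 then show ?thesis using main st by blast
    next
      case 2 then show ?thesis using main[OF st(2) st(1)] by (simp add: abs_minus_commute)
    qed simp
  qed
qed


text \<open>The \<open>q\<close>-th powers of all normalised dyadic increments have a finite total expectation: the \<open>2\<^sup>n\<close>
  increments of level \<open>n\<close> contribute at most \<open>C \<rho>\<^sup>n\<close> with \<open>\<rho> = 2\<^sup>\<beta>\<^sup>q\<^sup>-\<^sup>\<epsilon> < 1\<close>. Hence the sum is
  almost surely finite and bounds every single increment, without a Borel--Cantelli argument.\<close>

lemma kolmogorov_continuity:
  fixes X :: "real \<Rightarrow> 'w \<Rightarrow> real"
  assumes meas: "\<And>t. t \<in> {0..1} \<Longrightarrow> X t \<in> borel_measurable M"
    and cont: "AE \<omega> in M. continuous_on {0..1} (\<lambda>t. X t \<omega>)"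
    and moment: "\<And>s t. s \<in> {0..1} \<Longrightarrow> t \<in> {0..1} \<Longrightarrow>
      (\<integral>\<^sup>+\<omega>. ennreal (\<bar>X t \<omega> - X s \<omega>\<bar> ^ q) \<partial>M) \<le> ennreal (C * \<bar>t - s\<bar> powr (1 + \<epsilon>))"
    and C: "0 \<le> C" and \<beta>: "0 < \<beta>" "\<beta> * real q < \<epsilon>" and q: "0 < q"
  shows "AE \<omega> in M. hoelder_on \<beta> {0..1} (\<lambda>t. X t \<omega>)"
proof -
  define r where "r = 2 powr - \<beta>"
  define \<rho> where "\<rho> = 2 powr (\<beta> * real q - \<epsilon>)"
  have r: "0 < r" by (simp add: r_def)
  have \<rho>: "0 < \<rho>" "\<rho> < 1"
    using \<beta> by (auto simp: \<rho>_def powr_less_one)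
  define Y where "Y n k \<omega> = \<bar>X (real (Suc k) / 2 ^ n) \<omega> - X (real k / 2 ^ n) \<omega>\<bar> / r ^ n" for n k :: nat and \<omega>
  have grid: "real k / 2 ^ n \<in> {0..1}" if "k \<le> 2 ^ n" for k n
  proof -
    have "real k \<le> real (2 ^ n)" using that by (simp only: of_nat_le_iff)
    then show ?thesis by simp
  qed
  have [measurable]: "Y n k \<in> borel_measurable M" if "k < 2 ^ n" for n k
  proof -
    have *: "X (real (Suc k) / 2 ^ n) \<in> borel_measurable M" "X (real k / 2 ^ n) \<in> borel_measurable M"
      using that by (intro meas grid; simp)+
    show ?thesis
      unfolding Y_def[abs_def]
      by (intro borel_measurable_divide borel_measurable_abs borel_measurable_diff borel_measurable_const *)
  qed
  define S where "S \<omega> = (\<Sum>n. \<Sum>k<2 ^ n. ennreal (Y n k \<omega> ^ q))" for \<omega>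
  have mS: "(\<lambda>\<omega>. \<Sum>k<2 ^ n. ennreal (Y n k \<omega> ^ q)) \<in> borel_measurable M" for n
    by (intro borel_measurable_sum) (auto intro!: measurable_compose[OF _ measurable_ennreal] borel_measurable_power)
  have Y_moment: "(\<integral>\<^sup>+\<omega>. ennreal (Y n k \<omega> ^ q) \<partial>M) \<le> ennreal (C * \<rho> ^ n / 2 ^ n)" if k: "k < 2 ^ n" for n k
  proof -
    let ?s = "real k / 2 ^ n" and ?t = "real (Suc k) / 2 ^ n"
    have st: "?s \<in> {0..1}" "?t \<in> {0..1}"
      using k by (intro grid; simp)+
    have *: "X ?t \<in> borel_measurable M" "X ?s \<in> borel_measurable M"
      using meas st by blast+
    have "(\<integral>\<^sup>+\<omega>. ennreal (Y n k \<omega> ^ q) \<partial>M)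
        = (\<integral>\<^sup>+\<omega>. ennreal (1 / (r ^ n) ^ q) * ennreal (\<bar>X ?t \<omega> - X ?s \<omega>\<bar> ^ q) \<partial>M)"
      using r by (intro nn_integral_cong) (simp add: Y_def power_divide ennreal_mult[symmetric])
    also have "\<dots> = ennreal (1 / (r ^ n) ^ q) * (\<integral>\<^sup>+\<omega>. ennreal (\<bar>X ?t \<omega> - X ?s \<omega>\<bar> ^ q) \<partial>M)"
      by (intro nn_integral_cmult measurable_compose[OF _ measurable_ennreal] borel_measurable_power
        borel_measurable_abs borel_measurable_diff *)
    also have "\<dots> \<le> ennreal (1 / (r ^ n) ^ q) * ennreal (C * \<bar>?t - ?s\<bar> powr (1 + \<epsilon>))"
      by (intro mult_left_mono moment st) simp
    also have "\<dots> = ennreal (1 / (r ^ n) ^ q * (C * \<bar>?t - ?s\<bar> powr (1 + \<epsilon>)))"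
      using r C by (intro ennreal_mult[symmetric]) auto
    also have "1 / (r ^ n) ^ q * (C * \<bar>?t - ?s\<bar> powr (1 + \<epsilon>)) = C * \<rho> ^ n / 2 ^ n"
    proof -
      have "?t - ?s = 1 / 2 ^ n"
        by (simp add: field_simps)
      then have "\<bar>?t - ?s\<bar> powr (1 + \<epsilon>) = 2 powr (- (real n * (1 + \<epsilon>)))"
        by (simp add: powr_realpow[symmetric] powr_divide powr_powr powr_minus_divide)
      moreover have "(r ^ n) ^ q = 2 powr (- (\<beta> * real n * real q))"
        unfolding r_def by (simp add: powr_realpow[symmetric] powr_powr mult.assoc)
      then have "1 / (r ^ n) ^ q = 2 powr (\<beta> * real n * real q)"
        by (simp add: powr_minus_divide)
      moreover have "\<rho> ^ n / 2 ^ n = 2 powr (\<beta> * real n * real q) * 2 powr (- (real n * (1 + \<epsilon>)))"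
        unfolding \<rho>_def
        by (simp add: powr_realpow[symmetric] powr_powr powr_add[symmetric] powr_diff[symmetric] algebra_simps)
      moreover have "C * \<rho> ^ n / 2 ^ n = C * (\<rho> ^ n / 2 ^ n)"
        by simp
      ultimately show ?thesis
        by (simp only: ac_simps)
    qed
    finally show ?thesis .
  qed
  have "(\<integral>\<^sup>+\<omega>. S \<omega> \<partial>M) = (\<Sum>n. \<integral>\<^sup>+\<omega>. (\<Sum>k<2 ^ n. ennreal (Y n k \<omega> ^ q)) \<partial>M)"
    unfolding S_def by (intro nn_integral_suminf mS)
  also have "\<dots> \<le> (\<Sum>n. ennreal (C * \<rho> ^ n))"
  proof (intro suminf_le summableI)
    fix n
    have "(\<integral>\<^sup>+\<omega>. (\<Sum>k<2 ^ n. ennreal (Y n k \<omega> ^ q)) \<partial>M)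
        = (\<Sum>k<2 ^ n. \<integral>\<^sup>+\<omega>. ennreal (Y n k \<omega> ^ q) \<partial>M)"
      by (intro nn_integral_sum) (auto intro!: measurable_compose[OF _ measurable_ennreal] borel_measurable_power)
    also have "\<dots> \<le> (\<Sum>k<(2::nat) ^ n. ennreal (C * \<rho> ^ n / 2 ^ n))"
      by (intro sum_mono Y_moment) simp
    also have "\<dots> = ennreal (\<Sum>k<(2::nat) ^ n. C * \<rho> ^ n / 2 ^ n)"
      using C \<rho> by (intro sum_ennreal) simp
    also have "(\<Sum>k<(2::nat) ^ n. C * \<rho> ^ n / 2 ^ n) = C * \<rho> ^ n"
      by simp
    finally show "(\<integral>\<^sup>+\<omega>. (\<Sum>k<2 ^ n. ennreal (Y n k \<omega> ^ q)) \<partial>M) \<le> ennreal (C * \<rho> ^ n)" .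
  qed
  also have "\<dots> = ennreal (\<Sum>n. C * \<rho> ^ n)"
    using C \<rho> by (intro suminf_ennreal2 summable_mult summable_geometric) auto
  finally have "(\<integral>\<^sup>+\<omega>. S \<omega> \<partial>M) \<noteq> \<infinity>"
    by (auto simp: top_unique)
  then have "AE \<omega> in M. S \<omega> \<noteq> \<infinity>"
    using mS unfolding S_def by (intro nn_integral_PInf_AE borel_measurable_suminf) auto
  with cont show ?thesis
  proof eventually_elim
    case (elim \<omega>)
    obtain c where c: "S \<omega> = ennreal c" "0 \<le> c"
      using elim(2) by (cases "S \<omega>") auto
    show ?case
    proof (rule dyadic_increments_imp_hoelder_on[OF elim(1) \<beta>(1)])
      fix n k :: nat assume k: "k < 2 ^ n"
      have "ennreal (Y n k \<omega> ^ q) \<le> (\<Sum>k<2 ^ n. ennreal (Y n k \<omega> ^ q))"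
        using k by (intro member_le_sum) auto
      also have "\<dots> \<le> S \<omega>"
        unfolding S_def
        using sum_le_suminf[OF summableI, of "{n}" "\<lambda>n. \<Sum>k<2 ^ n. ennreal (Y n k \<omega> ^ q)"] by simp
      finally have "Y n k \<omega> ^ q \<le> c"
        using c by simp
      \<comment> \<open>A crude substitute for the \<open>q\<close>-th root, sufficient because only finiteness matters.\<close>
      moreover have "Y n k \<omega> \<le> 1 + Y n k \<omega> ^ q"
      proof (cases "Y n k \<omega> \<le> 1")
        case False
        then show ?thesis using self_le_power[of "Y n k \<omega>" q] q by simp
      next
        case True
        have "0 \<le> Y n k \<omega>" using r by (simp add: Y_def)
        then have "0 \<le> Y n k \<omega> ^ q" by simp
        with True show ?thesis by linarith
      qed
      ultimately have "Y n k \<omega> \<le> 1 + c"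
        by simp
      then show "\<bar>X (real (Suc k) / 2 ^ n) \<omega> - X (real k / 2 ^ n) \<omega>\<bar> \<le> (1 + c) * (2 powr - \<beta>) ^ n"
        using r unfolding Y_def r_def[symmetric] by (simp add: pos_divide_le_eq)
    qed
  qed
qed


lemma (in prob_space) gaussian_rv_square_integrable:
  assumes "gaussian_rv M X"
  shows "integrable M (\<lambda>\<omega>. (X \<omega>)\<^sup>2)"
proof -
  have [measurable]: "X \<in> borel_measurable M"
    using assms by (simp add: gaussian_rv_def)
  consider (normal) \<mu> \<sigma> where "\<sigma> > 0" "distributed M lborel X (normal_density \<mu> \<sigma>)"
    | (const) \<mu> where "AE \<omega> in M. X \<omega> = \<mu>"
    using assms by (auto simp: gaussian_rv_def)
  then show ?thesis
  proof cases
    case normal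
    have "integrable lborel (\<lambda>x. normal_density \<mu> \<sigma> x * (x - \<mu>) ^ 2
        + 2 * \<mu> * (normal_density \<mu> \<sigma> x * x) - \<mu>\<^sup>2 * normal_density \<mu> \<sigma> x)"
      using normal(1)
      by (intro Bochner_Integration.integrable_add Bochner_Integration.integrable_diff
          integrable_normal_moment integrable_mult_right integrable_normal_moment_nz_1
          integrable_normal_density)
    then have "integrable lborel (\<lambda>x. normal_density \<mu> \<sigma> x * x\<^sup>2)"
      by (rule back_subst[of "integrable lborel"])
        (simp add: fun_eq_iff algebra_simps power2_eq_square)
    then show ?thesis
      using distributed_integrable[OF normal(2), of "\<lambda>x. x\<^sup>2"] by simp
  next
    case const
    then have "AE \<omega> in M. (X \<omega>)\<^sup>2 = \<mu>\<^sup>2" by eventually_elim simp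
    then show ?thesis
      by (subst integrable_cong_AE[where g = "\<lambda>_. \<mu>\<^sup>2"]) auto
  qed
qed

lemma (in prob_space) centred_gaussian_even_moment:
  assumes "gaussian_rv M X" and mean: "expectation X = 0" and m: "0 < m"
  shows "(\<integral>\<^sup>+\<omega>. ennreal (X \<omega> ^ (2 * m)) \<partial>M)
    = ennreal (fact (2 * m) / (2 ^ m * fact m) * expectation (\<lambda>\<omega>. (X \<omega>)\<^sup>2) ^ m)"
proof -
  have [measurable]: "X \<in> borel_measurable M"
    using assms by (simp add: gaussian_rv_def)
  consider (normal) \<mu> \<sigma> where "\<sigma> > 0" "distributed M lborel X (normal_density \<mu> \<sigma>)"
    | (const) \<mu> where "AE \<omega> in M. X \<omega> = \<mu>"
    using assms by (auto simp: gaussian_rv_def)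
  then show ?thesis
  proof cases
    case normal
    have "\<mu> = 0"
      using distributed_integral[OF normal(2), of "\<lambda>x. x"] mean
        integral_normal_moment_nz_1[OF normal(1), of \<mu>] by simp
    with normal have D: "distributed M lborel X (normal_density 0 \<sigma>)" by simp
    have mom: "has_bochner_integral lborel (\<lambda>x. normal_density 0 \<sigma> x * x ^ (2 * k))
        (fact (2 * k) / ((2 / \<sigma>\<^sup>2) ^ k * fact k))" for k
      using normal_moment_even[OF normal(1), of 0 k] by simp
    have var: "expectation (\<lambda>\<omega>. (X \<omega>)\<^sup>2) = \<sigma>\<^sup>2"
      using distributed_integral[OF D, of "\<lambda>x. x\<^sup>2"] has_bochner_integral_integral_eq[OF mom[of 1]]
      by simp
    have "(\<integral>\<^sup>+\<omega>. ennreal (X \<omega> ^ (2 * m)) \<partial>M)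
        = (\<integral>\<^sup>+x. ennreal (normal_density 0 \<sigma> x) * ennreal (x ^ (2 * m)) \<partial>lborel)"
      by (intro distributed_nn_integral[OF D, symmetric]) simp
    also have "\<dots> = (\<integral>\<^sup>+x. ennreal (normal_density 0 \<sigma> x * x ^ (2 * m)) \<partial>lborel)"
      by (simp add: ennreal_mult)
    also have "\<dots> = ennreal (fact (2 * m) / ((2 / \<sigma>\<^sup>2) ^ m * fact m))"
      using mom[of m] by (subst nn_integral_eq_integral)
        (auto simp: has_bochner_integral_iff intro!: AE_I2 mult_nonneg_nonneg)
    also have "fact (2 * m) / ((2 / \<sigma>\<^sup>2) ^ m * fact m) = fact (2 * m) / (2 ^ m * fact m) * (\<sigma>\<^sup>2) ^ m"
      by (simp add: power_divide)
    finally show ?thesis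
      by (simp add: var)
  next
    case const
    have "\<mu> = 0"
      using mean integral_cong_AE[of X M "\<lambda>_. \<mu>"] const by (simp add: prob_space)
    with const have X0: "AE \<omega> in M. X \<omega> = 0" by simp
    have "(\<integral>\<^sup>+\<omega>. ennreal (X \<omega> ^ (2 * m)) \<partial>M) = (\<integral>\<^sup>+\<omega>. 0 \<partial>M)"
      using X0 m by (intro nn_integral_cong_AE) (auto elim!: eventually_mono)
    moreover have "expectation (\<lambda>\<omega>. (X \<omega>)\<^sup>2) = expectation (\<lambda>\<omega>. 0)"
      using X0 by (intro integral_cong_AE) (auto elim!: eventually_mono)
    ultimately show ?thesis
      using m by simp
  qed
qed

text \<open>The variance comes from expanding the square and inserting the covariance function, which is
  legitimate because Gaussian variables are square integrable.\<close>

lemma (in prob_space) fractional_brownian_increment: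
  assumes fbm: "fractional_brownian_motion M H W" and st: "0 \<le> s" "0 \<le> t" "s \<noteq> t"
  shows "gaussian_rv M (\<lambda>\<omega>. W t \<omega> - W s \<omega>)" (is ?gaussian)
    and "expectation (\<lambda>\<omega>. W t \<omega> - W s \<omega>) = 0" (is ?mean)
    and "expectation (\<lambda>\<omega>. (W t \<omega> - W s \<omega>)\<^sup>2) = \<bar>t - s\<bar> powr (2 * H)" (is ?variance)
proof -
  have gp: "gaussian_process M W"
    using fbm by (simp add: fractional_brownian_motion_def)
  have g: "gaussian_rv M (W u)" if "0 \<le> u" for u
    using gp[unfolded gaussian_process_def, rule_format, of "{u}" "\<lambda>_. 1"] that by simp
  have [measurable]: "W s \<in> borel_measurable M" "W t \<in> borel_measurable M"
    using g st by (auto simp: gaussian_rv_def)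
  show ?gaussian
    using gp[unfolded gaussian_process_def, rule_format, of "{s, t}" "\<lambda>u. if u = t then 1 else - 1"] st
    by simp
  have sq: "integrable M (\<lambda>\<omega>. (W s \<omega>)\<^sup>2)" "integrable M (\<lambda>\<omega>. (W t \<omega>)\<^sup>2)"
    using st g by (auto intro: gaussian_rv_square_integrable)
  have int: "integrable M (W s)" "integrable M (W t)"
    using sq by (auto intro: square_integrable_imp_integrable)
  have cross: "integrable M (\<lambda>\<omega>. W s \<omega> * W t \<omega>)"
  proof (rule Bochner_Integration.integrable_bound)
    show "integrable M (\<lambda>\<omega>. (W s \<omega>)\<^sup>2 + (W t \<omega>)\<^sup>2)"
      using sq by (rule Bochner_Integration.integrable_add)
    have "\<bar>x * y\<bar> \<le> x\<^sup>2 + y\<^sup>2" for x y :: real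
      using sum_squares_bound[of "\<bar>x\<bar>" "\<bar>y\<bar>"] mult_nonneg_nonneg[of "\<bar>x\<bar>" "\<bar>y\<bar>"]
      by (simp add: abs_mult del: mult_nonneg_nonneg)
    then show "AE \<omega> in M. norm (W s \<omega> * W t \<omega>) \<le> norm ((W s \<omega>)\<^sup>2 + (W t \<omega>)\<^sup>2)"
      by (simp add: AE_I2)
  qed simp
  show ?mean
    using fbm st int by (simp add: fractional_brownian_motion_def)
  have cov: "expectation (\<lambda>\<omega>. W u \<omega> * W v \<omega>)
      = (1/2) * (v powr (2 * H) + u powr (2 * H) - \<bar>v - u\<bar> powr (2 * H))" if "0 \<le> u" "0 \<le> v" for u v
    using fbm that by (simp add: fractional_brownian_motion_def)
  have "expectation (\<lambda>\<omega>. (W t \<omega> - W s \<omega>)\<^sup>2)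
      = expectation (\<lambda>\<omega>. (W t \<omega>)\<^sup>2 + (W s \<omega>)\<^sup>2 - 2 * (W s \<omega> * W t \<omega>))"
    by (simp add: power2_eq_square algebra_simps)
  also have "\<dots> = expectation (\<lambda>\<omega>. (W t \<omega>)\<^sup>2) + expectation (\<lambda>\<omega>. (W s \<omega>)\<^sup>2) - 2 * expectation (\<lambda>\<omega>. W s \<omega> * W t \<omega>)"
    using sq cross by simp
  also have "\<dots> = \<bar>t - s\<bar> powr (2 * H)"
    using cov[of t t] cov[of s s] cov[of s t] st by (simp add: power2_eq_square)
  finally show ?variance .
qed

text \<open>The \<open>2m\<close>-th moment of an increment is a multiple of \<open>|t - s|\<^sup>2\<^sup>H\<^sup>m\<close>, so Kolmogorov's criterion
  gives all orders below \<open>H - 1 / (2m)\<close>.\<close>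

lemma (in prob_space) fractional_brownian_paths_hoelder:
  assumes fbm: "fractional_brownian_motion M H W" and \<beta>: "0 < \<beta>" "\<beta> < H"
  shows "AE \<omega> in M. hoelder_on \<beta> {0..1} (\<lambda>t. W t \<omega>)"
proof -
  obtain m :: nat where m: "1 / (2 * (H - \<beta>)) < real m"
    using reals_Archimedean2 by blast
  have m0: "0 < m"
    using m \<beta> by (cases m) (auto simp: field_simps)
  \<comment> \<open>The \<open>2m\<close>-th moment of a standard normal variable.\<close>
  define C :: real where "C = fact (2 * m) / (2 ^ m * fact m)"
  have gp: "gaussian_process M W"
    using fbm by (simp add: fractional_brownian_motion_def)
  have meas: "W t \<in> borel_measurable M" if "t \<in> {0..1}" for t
    using gp[unfolded gaussian_process_def, rule_format, of "{t}" "\<lambda>_. 1"] that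
    by (simp add: gaussian_rv_def)
  have cont: "AE \<omega> in M. continuous_on {0..1} (\<lambda>t. W t \<omega>)"
    using fbm unfolding fractional_brownian_motion_def continuous_paths_def
    by (auto elim!: eventually_mono intro: continuous_on_subset)
  have moment: "(\<integral>\<^sup>+\<omega>. ennreal (\<bar>W t \<omega> - W s \<omega>\<bar> ^ (2 * m)) \<partial>M)
      \<le> ennreal (C * \<bar>t - s\<bar> powr (1 + (2 * H * real m - 1)))" if "s \<in> {0..1}" "t \<in> {0..1}" for s t
  proof (cases "s = t")
    case True
    then show ?thesis using m0 by simp
  next
    case False
    then have st: "0 \<le> s" "0 \<le> t" "s \<noteq> t" using that by auto
    show ?thesis
      using centred_gaussian_even_moment[OF fractional_brownian_increment(1,2)[OF fbm st] m0] st
      by (simp add: fractional_brownian_increment(3)[OF fbm st] C_def power_even_abs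
          powr_realpow[symmetric] powr_powr)
  qed
  show ?thesis
  proof (rule kolmogorov_continuity[OF meas cont moment])
    show "0 \<le> C" by (simp add: C_def)
    show "\<beta> * real (2 * m) < 2 * H * real m - 1"
      using m \<beta> by (simp add: field_simps)
  qed (use \<beta> m0 in auto)
qed

section \<open>Boundedness of the fractional integral\<close>

text \<open>This also covers the case that \<open>f\<close> is not integrable, in which its integral is \<open>0\<close> by convention.\<close>

lemma abs_set_integral_le:
  fixes f h :: "'b \<Rightarrow> real"
  assumes h: "set_integrable M S h" and le: "AE x in M. x \<in> S \<longrightarrow> \<bar>f x\<bar> \<le> h x"
  shows "\<bar>LINT x:S|M. f x\<bar> \<le> (LINT x:S|M. h x)"
proof -
  have "\<bar>LINT x:S|M. f x\<bar> \<le> (\<integral>x. \<bar>indicator S x *\<^sub>R f x\<bar> \<partial>M)"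
    unfolding set_lebesgue_integral_def by (rule integral_abs_bound)
  also have "\<dots> \<le> (\<integral>x. indicator S x *\<^sub>R h x \<partial>M)"
  proof (rule integral_mono_AE')
    show "integrable M (\<lambda>x. indicator S x *\<^sub>R h x)"
      using h by (simp add: set_integrable_def)
    show "AE x in M. \<bar>indicator S x *\<^sub>R f x\<bar> \<le> indicator S x *\<^sub>R h x"
      using le by eventually_elim (auto simp: indicator_def)
    show "AE x in M. 0 \<le> indicator S x *\<^sub>R h x"
      using le by eventually_elim (auto simp: indicator_def)
  qed
  finally show ?thesis
    by (simp add: set_lebesgue_integral_def)
qed

lemma has_bochner_integral_powr_from_0:
  fixes e c :: real
  assumes "-1 < e" "0 \<le> c"
  shows "has_bochner_integral lborel (\<lambda>x. indicator {0..c} x * x powr e) (c powr (e + 1) / (e + 1))"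
proof (rule has_bochner_integral_nn_integral)
  show "(\<integral>\<^sup>+x. ennreal (indicator {0..c} x * x powr e) \<partial>lborel) = ennreal (c powr (e + 1) / (e + 1))"
    by (intro nn_integral_has_integral_lebesgue has_integral_powr_from_0 assms) auto
qed (use assms in \<open>auto simp: indicator_def\<close>)

lemma powr_before_integral:
  fixes e x :: real
  assumes "-1 < e" "0 \<le> x"
  shows "set_integrable lborel {0..x} (\<lambda>y. (x - y) powr e)"
    and "(LINT y:{0..x}|lborel. (x - y) powr e) = x powr (e + 1) / (e + 1)"
proof -
  have "has_bochner_integral lborel (\<lambda>y. indicator {0..x} (x + (-1) * y) * (x + (-1) * y) powr e)
      ((x powr (e + 1) / (e + 1)) /\<^sub>R \<bar>-1\<bar>)"
    by (rule lborel_has_bochner_integral_real_affine_iff[THEN iffD1, OF _ has_bochner_integral_powr_from_0])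
      (use assms in auto)
  moreover have "indicator {0..x} (x + (-1) * y) = (indicator {0..x} y :: real)" for y
    by (auto simp: indicator_def)
  ultimately have "has_bochner_integral lborel (\<lambda>y. indicator {0..x} y * (x - y) powr e) (x powr (e + 1) / (e + 1))"
    by simp
  then show "set_integrable lborel {0..x} (\<lambda>y. (x - y) powr e)"
    and "(LINT y:{0..x}|lborel. (x - y) powr e) = x powr (e + 1) / (e + 1)"
    by (auto simp: set_integrable_def set_lebesgue_integral_def has_bochner_integral_iff)
qed

lemma powr_after_integral:
  fixes e x t :: real
  assumes "-1 < e" "x \<le> t"
  shows "set_integrable lborel {x..t} (\<lambda>y. (y - x) powr e)"
    and "(LINT y:{x..t}|lborel. (y - x) powr e) = (t - x) powr (e + 1) / (e + 1)"
proof -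
  have "has_bochner_integral lborel (\<lambda>y. indicator {0..t - x} (- x + 1 * y) * (- x + 1 * y) powr e)
      (((t - x) powr (e + 1) / (e + 1)) /\<^sub>R \<bar>1\<bar>)"
    by (rule lborel_has_bochner_integral_real_affine_iff[THEN iffD1, OF _ has_bochner_integral_powr_from_0])
      (use assms in auto)
  moreover have "indicator {0..t - x} (- x + 1 * y) = (indicator {x..t} y :: real)" for y
    by (auto simp: indicator_def)
  ultimately have "has_bochner_integral lborel (\<lambda>y. indicator {x..t} y * (y - x) powr e) ((t - x) powr (e + 1) / (e + 1))"
    by simp
  then show "set_integrable lborel {x..t} (\<lambda>y. (y - x) powr e)"
    and "(LINT y:{x..t}|lborel. (y - x) powr e) = (t - x) powr (e + 1) / (e + 1)"
    by (auto simp: set_integrable_def set_lebesgue_integral_def has_bochner_integral_iff)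
qed

lemma hoelder_quotient_le:
  fixes u C h :: real
  assumes "\<bar>u\<bar> \<le> C * h powr \<beta>" "0 \<le> h"
  shows "\<bar>u / h powr e\<bar> \<le> C * h powr (\<beta> - e)"
proof (cases "h = 0")
  case False
  with assms show ?thesis
    by (simp add: abs_divide powr_diff pos_divide_le_eq)
qed simp

text \<open>The difference quotient is at most \<open>C (x - y)\<^sup>\<alpha>\<^sup>-\<^sup>\<gamma>\<^sup>-\<^sup>1\<close>, which is integrable up to \<open>y = x\<close> since
  \<open>\<gamma> < \<alpha>\<close>; what remains is the boundary term, singular at the origin.\<close>

lemma left_frac_deriv_bound:
  assumes \<gamma>: "0 < \<gamma>" "\<gamma> < 1" "\<gamma> < \<alpha>" and x: "0 < x" "x \<le> 1" and C: "0 \<le> C"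
    and f: "\<bar>f x\<bar> \<le> B" and hoelder: "\<And>y. y \<in> {0..x} \<Longrightarrow> \<bar>f x - f y\<bar> \<le> C * (x - y) powr \<alpha>"
  shows "\<bar>left_frac_deriv \<gamma> f x\<bar> \<le> 1 / Gamma (1 - \<gamma>) * (B * x powr - \<gamma> + \<gamma> * (C / (\<alpha> - \<gamma>)))"
proof -
  have "\<bar>LINT y:{0..x}|lborel. (f x - f y) / (x - y) powr (\<gamma> + 1)\<bar>
      \<le> (LINT y:{0..x}|lborel. C * (x - y) powr (\<alpha> - (\<gamma> + 1)))"
    using \<gamma> x hoelder
    by (intro abs_set_integral_le set_integrable_mult_right powr_before_integral AE_I2 impI hoelder_quotient_le) auto
  also have "\<dots> = C * (x powr (\<alpha> - \<gamma>) / (\<alpha> - \<gamma>))"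
    using powr_before_integral(2)[of "\<alpha> - (\<gamma> + 1)" x] \<gamma> x by simp
  also have "\<dots> \<le> C * (1 / (\<alpha> - \<gamma>))"
    using \<gamma> x C by (intro mult_left_mono divide_right_mono powr_le1) auto
  finally have *: "\<bar>LINT y:{0..x}|lborel. (f x - f y) / (x - y) powr (\<gamma> + 1)\<bar> \<le> C / (\<alpha> - \<gamma>)"
    by simp
  have "\<bar>f x / x powr \<gamma>\<bar> \<le> B * x powr - \<gamma>"
    using f x by (simp add: abs_divide powr_minus_divide divide_right_mono)
  moreover have "\<bar>\<gamma> * (LINT y:{0..x}|lborel. (f x - f y) / (x - y) powr (\<gamma> + 1))\<bar> \<le> \<gamma> * (C / (\<alpha> - \<gamma>))"
    using * \<gamma> by (simp only: abs_mult abs_of_pos[OF \<gamma>(1)]) (intro mult_left_mono; simp)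
  ultimately have "\<bar>f x / x powr \<gamma> + \<gamma> * (LINT y:{0..x}|lborel. (f x - f y) / (x - y) powr (\<gamma> + 1))\<bar>
      \<le> B * x powr - \<gamma> + \<gamma> * (C / (\<alpha> - \<gamma>))"
    by linarith
  moreover have "0 < Gamma (1 - \<gamma>)"
    using \<gamma> by (intro Gamma_real_pos) simp
  ultimately show ?thesis
    unfolding left_frac_deriv_def by (simp only: abs_mult abs_divide abs_one abs_of_pos) (intro mult_left_mono; simp)
qed

text \<open>Here the boundary term is itself an increment of \<open>g\<close>, so there is no singularity at \<open>t\<close>.\<close>

lemma right_frac_deriv_bound:
  assumes \<delta>: "0 < \<delta>" "\<delta> < 1" "\<delta> < \<beta>" and x: "x < t" "t \<le> x + 1" and C: "0 \<le> C"
    and hoelder: "\<And>y. y \<in> {x..t} \<Longrightarrow> \<bar>g x - g y\<bar> \<le> C * (y - x) powr \<beta>"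
  shows "\<bar>right_frac_deriv \<delta> t g x\<bar> \<le> 1 / Gamma (1 - \<delta>) * (C + \<delta> * (C / (\<beta> - \<delta>)))"
proof -
  have "\<bar>LINT y:{x..t}|lborel. (g x - g y) / (y - x) powr (\<delta> + 1)\<bar>
      \<le> (LINT y:{x..t}|lborel. C * (y - x) powr (\<beta> - (\<delta> + 1)))"
    using \<delta> x hoelder
    by (intro abs_set_integral_le set_integrable_mult_right powr_after_integral AE_I2 impI hoelder_quotient_le) auto
  also have "\<dots> = C * ((t - x) powr (\<beta> - \<delta>) / (\<beta> - \<delta>))"
    using powr_after_integral(2)[of "\<beta> - (\<delta> + 1)" x t] \<delta> x by simp
  also have "\<dots> \<le> C * (1 / (\<beta> - \<delta>))"
    using \<delta> x C by (intro mult_left_mono divide_right_mono powr_le1) auto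
  finally have *: "\<bar>LINT y:{x..t}|lborel. (g x - g y) / (y - x) powr (\<delta> + 1)\<bar> \<le> C / (\<beta> - \<delta>)"
    by simp
  have "\<bar>(g x - g t) / (t - x) powr \<delta>\<bar> \<le> C * (t - x) powr (\<beta> - \<delta>)"
    using hoelder[of t] x by (intro hoelder_quotient_le) auto
  also have "\<dots> \<le> C * 1"
    using \<delta> x C by (intro mult_left_mono powr_le1) auto
  finally have "\<bar>(g x - g t) / (t - x) powr \<delta>\<bar> \<le> C" by simp
  moreover have "\<bar>\<delta> * (LINT y:{x..t}|lborel. (g x - g y) / (y - x) powr (\<delta> + 1))\<bar> \<le> \<delta> * (C / (\<beta> - \<delta>))"
    using * \<delta> by (simp only: abs_mult abs_of_pos[OF \<delta>(1)]) (intro mult_left_mono; simp)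
  ultimately have "\<bar>(g x - g t) / (t - x) powr \<delta> + \<delta> * (LINT y:{x..t}|lborel. (g x - g y) / (y - x) powr (\<delta> + 1))\<bar>
      \<le> C + \<delta> * (C / (\<beta> - \<delta>))"
    by linarith
  moreover have "0 < Gamma (1 - \<delta>)"
    using \<delta> by (intro Gamma_real_pos) simp
  ultimately show ?thesis
    unfolding right_frac_deriv_def by (simp only: abs_mult abs_divide abs_one abs_of_pos) (intro mult_left_mono; simp)
qed

lemma hoelder_on_subset: "hoelder_on \<beta> S f \<Longrightarrow> S' \<subseteq> S \<Longrightarrow> hoelder_on \<beta> S' f"
  unfolding hoelder_on_def by blast

lemma hoelder_on_nonneg_constant:
  assumes "hoelder_on \<beta> S f"
  obtains C where "0 \<le> C" "\<And>s t. s \<in> S \<Longrightarrow> t \<in> S \<Longrightarrow> \<bar>f t - f s\<bar> \<le> C * \<bar>t - s\<bar> powr \<beta>"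
proof -
  obtain C where C: "\<And>s t. s \<in> S \<Longrightarrow> t \<in> S \<Longrightarrow> \<bar>f t - f s\<bar> \<le> C * \<bar>t - s\<bar> powr \<beta>"
    using assms by (auto simp: hoelder_on_def)
  have "\<bar>f t - f s\<bar> \<le> max C 0 * \<bar>t - s\<bar> powr \<beta>" if "s \<in> S" "t \<in> S" for s t
    using C[OF that] mult_right_mono[of C "max C 0" "\<bar>t - s\<bar> powr \<beta>"] by simp
  then show ?thesis
    using that[of "max C 0"] by simp
qed

text \<open>The integrand of the fractional integral is dominated by a constant plus a multiple of \<open>x\<^sup>-\<^sup>\<gamma>\<close>,
  uniformly in the upper limit \<open>t\<close>.\<close>

lemma frac_integral_bounded:
  assumes \<gamma>: "0 < \<gamma>" "\<gamma> < 1" "\<gamma> < \<alpha>" "1 - \<gamma> < \<beta>"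
    and f: "hoelder_on \<alpha> {0..1} f" and g: "hoelder_on \<beta> {0..1} g"
  shows "\<exists>B. \<forall>t\<in>{0..1}. \<bar>frac_integral \<gamma> f g t\<bar> \<le> B"
proof -
  obtain C where C: "0 \<le> C" "\<And>s t. s \<in> {0..1} \<Longrightarrow> t \<in> {0..1} \<Longrightarrow> \<bar>f t - f s\<bar> \<le> C * \<bar>t - s\<bar> powr \<alpha>"
    using hoelder_on_nonneg_constant[OF f] by blast
  obtain E where E: "0 \<le> E" "\<And>s t. s \<in> {0..1} \<Longrightarrow> t \<in> {0..1} \<Longrightarrow> \<bar>g t - g s\<bar> \<le> E * \<bar>t - s\<bar> powr \<beta>"
    using hoelder_on_nonneg_constant[OF g] by blast
  define c where "c = 1 / Gamma (1 - \<gamma>)"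
  have c: "0 < c"
    using \<gamma> by (simp add: c_def Gamma_real_pos)
  define R where "R = 1 / Gamma \<gamma> * (E + (1 - \<gamma>) * (E / (\<beta> - (1 - \<gamma>))))"
  have R: "0 \<le> R"
    unfolding R_def using \<gamma> E Gamma_real_pos[of \<gamma>] by (intro mult_nonneg_nonneg add_nonneg_nonneg divide_nonneg_nonneg) auto
  define B where "B = \<bar>f 0\<bar> + C"
  define J where "J = \<gamma> * (C / (\<alpha> - \<gamma>))"
  have J: "0 \<le> J" using \<gamma> C by (simp add: J_def)
  have B: "0 \<le> B" using C by (simp add: B_def)
  have fB: "\<bar>f x\<bar> \<le> B" if "x \<in> {0..1}" for x
  proof -
    have "\<bar>f x - f 0\<bar> \<le> C * \<bar>x - 0\<bar> powr \<alpha>"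
      using C(2)[of 0 x] that by simp
    also have "\<dots> \<le> C * 1"
      using that C \<gamma> by (intro mult_left_mono powr_le1) auto
    finally show ?thesis by (simp add: B_def)
  qed
  have main: "\<bar>frac_integral \<gamma> f g t\<bar> \<le> R * c * B * (1 / (1 - \<gamma>)) + R * c * J" if t: "t \<in> {0..1}" for t
  proof -
    have int: "set_integrable lborel {0..t} (\<lambda>x. R * c * B * x powr - \<gamma>)"
      using powr_after_integral(1)[of "- \<gamma>" 0 t] \<gamma> t by (intro set_integrable_mult_right) simp
    have int': "set_integrable lborel {0..t} (\<lambda>x. R * c * J)"
      by (intro borel_integrable_atLeastAtMost' continuous_intros)
    have "\<bar>LINT x:{0..t}|lborel. left_frac_deriv \<gamma> f x * right_frac_deriv (1 - \<gamma>) t g x\<bar>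
        \<le> (LINT x:{0..t}|lborel. R * c * B * x powr - \<gamma> + R * c * J)"
    proof (rule abs_set_integral_le)
      show "set_integrable lborel {0..t} (\<lambda>x. R * c * B * x powr - \<gamma> + R * c * J)"
        by (intro set_integral_add int int')
      show "AE x in lborel. x \<in> {0..t} \<longrightarrow>
          \<bar>left_frac_deriv \<gamma> f x * right_frac_deriv (1 - \<gamma>) t g x\<bar> \<le> R * c * B * x powr - \<gamma> + R * c * J"
        using AE_lborel_singleton[of 0] AE_lborel_singleton[of t]
      proof eventually_elim
        case (elim x)
        show ?case
        proof
          assume "x \<in> {0..t}"
          with elim t have x: "0 < x" "x < t" "t \<le> 1" by auto
          have "\<bar>left_frac_deriv \<gamma> f x\<bar> \<le> c * (B * x powr - \<gamma> + J)"
            unfolding c_def J_def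
          proof (rule left_frac_deriv_bound[OF \<gamma>(1-3)])
            show "\<bar>f x - f y\<bar> \<le> C * (x - y) powr \<alpha>" if "y \<in> {0..x}" for y
              using C(2)[of y x] that x by simp
          qed (use x C fB in auto)
          moreover have "\<bar>right_frac_deriv (1 - \<gamma>) t g x\<bar> \<le> 1 / Gamma (1 - (1 - \<gamma>)) * (E + (1 - \<gamma>) * (E / (\<beta> - (1 - \<gamma>))))"
          proof (rule right_frac_deriv_bound)
            show "\<bar>g x - g y\<bar> \<le> E * (y - x) powr \<beta>" if "y \<in> {x..t}" for y
              using E(2)[of x y] that x by (simp add: abs_minus_commute)
          qed (use x E \<gamma> in auto)
          then have "\<bar>right_frac_deriv (1 - \<gamma>) t g x\<bar> \<le> R"
            by (simp add: R_def)
          ultimately have "\<bar>left_frac_deriv \<gamma> f x * right_frac_deriv (1 - \<gamma>) t g x\<bar> \<le> (c * (B * x powr - \<gamma> + J)) * R"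
            unfolding abs_mult using c B J by (intro mult_mono) auto
          then show "\<bar>left_frac_deriv \<gamma> f x * right_frac_deriv (1 - \<gamma>) t g x\<bar> \<le> R * c * B * x powr - \<gamma> + R * c * J"
            by (simp add: algebra_simps)
        qed
      qed
    qed
    also have "\<dots> = R * c * B * (t powr (1 - \<gamma>) / (1 - \<gamma>)) + R * c * J * t"
      using powr_after_integral(2)[of "- \<gamma>" 0 t] \<gamma> t
      by (subst set_integral_add(2)[OF int int']) (simp_all add: set_lebesgue_integral_def)
    also have "\<dots> \<le> R * c * B * (1 / (1 - \<gamma>)) + R * c * J"
      using \<gamma> t R c B J
      by (intro add_mono mult_left_mono divide_right_mono powr_le1 mult_right_le_one_le mult_nonneg_nonneg) auto
    finally show ?thesis
      by (simp add: frac_integral_def)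
  qed
  then show ?thesis by blast
qed

text \<open>The integral over \<open>[0, t]\<close> depends on the two functions only there; this allows
  replacing functions on the half-line by Borel functions on the whole line.\<close>

lemma frac_integral_cong:
  assumes "\<And>x. x \<in> {0..t} \<Longrightarrow> f x = f' x" "\<And>x. x \<in> {0..t} \<Longrightarrow> g x = g' x"
  shows "frac_integral \<gamma> f g t = frac_integral \<gamma> f' g' t"
proof -
  have "left_frac_deriv \<gamma> f x = left_frac_deriv \<gamma> f' x" if "x \<in> {0..t}" for x
    unfolding left_frac_deriv_def using that assms by (auto intro!: set_lebesgue_integral_cong arg_cong2[where f = "(+)"])
  moreover have "right_frac_deriv (1 - \<gamma>) t g x = right_frac_deriv (1 - \<gamma>) t g' x" if "x \<in> {0..t}" for x
    unfolding right_frac_deriv_def using that assms by (auto intro!: set_lebesgue_integral_cong arg_cong2[where f = "(+)"])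
  ultimately show ?thesis
    unfolding frac_integral_def by (auto intro!: set_lebesgue_integral_cong)
qed

lemma borel_measurable_frac_integral:
  assumes [measurable]: "f \<in> borel_measurable borel" "g \<in> borel_measurable borel"
  shows "(\<lambda>t. frac_integral \<gamma> f g t) \<in> borel_measurable borel"
proof -
  have ind: "indicator {u..v} y = (if u \<le> y \<and> y \<le> v then 1 else 0 :: real)" for u v y :: real
    by (simp add: indicator_def)
  have [measurable]: "left_frac_deriv \<gamma> f \<in> borel_measurable borel"
    unfolding left_frac_deriv_def[abs_def] set_lebesgue_integral_def ind by measurable
  have [measurable]: "(\<lambda>(t, x). right_frac_deriv (1 - \<gamma>) t g x) \<in> borel_measurable (borel \<Otimes>\<^sub>M borel)"
    unfolding right_frac_deriv_def[abs_def] set_lebesgue_integral_def ind by measurable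
  show ?thesis
    unfolding frac_integral_def[abs_def] set_lebesgue_integral_def ind by measurable
qed

lemma hoelder_on_imp_continuous_on:
  assumes "0 < \<alpha>" "hoelder_on \<alpha> S f"
  shows "continuous_on S f"
proof -
  obtain C where C: "0 \<le> C" "\<And>s t. s \<in> S \<Longrightarrow> t \<in> S \<Longrightarrow> \<bar>f t - f s\<bar> \<le> C * \<bar>t - s\<bar> powr \<alpha>"
    using hoelder_on_nonneg_constant[OF assms(2)] by blast
  show ?thesis
    unfolding continuous_on_def
  proof
    fix s assume s: "s \<in> S"
    have "((\<lambda>t. C * \<bar>t - s\<bar> powr \<alpha>) \<longlongrightarrow> C * 0) (at s within S)"
      using assms(1) by (intro tendsto_mult tendsto_const tendsto_zero_powrI[where b = \<alpha>] tendsto_rabs_zero)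
        (auto intro!: tendsto_eq_intros)
    then have lim: "((\<lambda>t. C * \<bar>t - s\<bar> powr \<alpha>) \<longlongrightarrow> 0) (at s within S)"
      by simp
    have "\<forall>\<^sub>F t in at s within S. norm (f t - f s) \<le> C * \<bar>t - s\<bar> powr \<alpha>"
      unfolding eventually_at_filter by (rule always_eventually) (use C(2)[OF s] in simp)
    then have "((\<lambda>t. f t - f s) \<longlongrightarrow> 0) (at s within S)"
      by (rule Lim_null_comparison[OF _ lim])
    then show "(f \<longlongrightarrow> f s) (at s within S)"
      by (rule LIM_zero_cancel)
  qed
qed

text \<open>Freezing a path at its initial value for negative times preserves continuity, so the result is Borel
  on the whole line.\<close>

lemma continuous_on_atLeast_0_extend:
  fixes f :: "real \<Rightarrow> real"
  assumes "continuous_on {0..} f"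
  shows "(\<lambda>t. f (max 0 t)) \<in> borel_measurable borel"
  by (rule borel_measurable_continuous_onI, rule continuous_on_compose2[OF assms, of UNIV "\<lambda>t. max 0 t"])
    (auto intro: continuous_on_max continuous_on_const continuous_on_id)

lemma noise_path_regular:
  assumes \<gamma>: "0 < \<gamma>" "\<gamma> < 1" "\<gamma> < \<alpha>" "1 - \<gamma> < \<beta>"
    and b: "hoelder_on \<alpha> {0..} b" and W: "continuous_on {0..} W" "hoelder_on \<beta> {0..1} W"
    and Y: "continuous_on {0..} Y"
    and n: "\<And>t. 0 \<le> t \<Longrightarrow> n t = Y t + frac_integral \<gamma> b W t"
  shows "set_borel_measurable lborel {0..} n" "\<exists>B. \<forall>t\<in>{0..1}. \<bar>n t\<bar> \<le> B"
proof -
  have b_cont: "continuous_on {0..} b"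
    using b \<gamma> by (intro hoelder_on_imp_continuous_on[of \<alpha>]) auto
  have n': "n t = Y (max 0 t) + frac_integral \<gamma> (\<lambda>s. b (max 0 s)) (\<lambda>s. W (max 0 s)) t" if "0 \<le> t" for t
    using n[OF that] frac_integral_cong[of t b "\<lambda>s. b (max 0 s)" W "\<lambda>s. W (max 0 s)" \<gamma>] that by simp
  note [measurable] = borel_measurable_frac_integral[OF continuous_on_atLeast_0_extend[OF b_cont]
      continuous_on_atLeast_0_extend[OF W(1)], of \<gamma>] continuous_on_atLeast_0_extend[OF Y]
  have "(\<lambda>t. indicator {0..} t *\<^sub>R (Y (max 0 t) + frac_integral \<gamma> (\<lambda>s. b (max 0 s)) (\<lambda>s. W (max 0 s)) t))
      \<in> borel_measurable borel"
    by measurable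
  also have "(\<lambda>t. indicator {0..} t *\<^sub>R (Y (max 0 t) + frac_integral \<gamma> (\<lambda>s. b (max 0 s)) (\<lambda>s. W (max 0 s)) t))
      = (\<lambda>t. indicator {0..} t *\<^sub>R n t)"
    using n' by (auto simp: fun_eq_iff indicator_def)
  finally show "set_borel_measurable lborel {0..} n"
    by (simp add: set_borel_measurable_def)
  obtain B where B: "\<And>t. t \<in> {0..1} \<Longrightarrow> \<bar>frac_integral \<gamma> b W t\<bar> \<le> B"
    using frac_integral_bounded[OF \<gamma> hoelder_on_subset[OF b, of "{0..1}"] W(2)] by fastforce
  have "bounded (Y ` {0..1})"
    using Y by (intro compact_imp_bounded compact_continuous_image) (auto intro: continuous_on_subset)
  then obtain B' where "\<And>t. t \<in> {0..1} \<Longrightarrow> \<bar>Y t\<bar> \<le> B'"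
    unfolding bounded_iff real_norm_def by fast
  then have "\<bar>n t\<bar> \<le> B' + B" if "t \<in> {0..1}" for t
  proof -
    have "n t = Y t + frac_integral \<gamma> b W t"
      using n[of t] that by simp
    moreover have "\<bar>Y t\<bar> \<le> B'" "\<bar>frac_integral \<gamma> b W t\<bar> \<le> B"
      using B[OF that] \<open>\<And>t. t \<in> {0..1} \<Longrightarrow> \<bar>Y t\<bar> \<le> B'\<close>[OF that] by blast+
    ultimately show ?thesis by linarith
  qed
  then show "\<exists>B. \<forall>t\<in>{0..1}. \<bar>n t\<bar> \<le> B" by blast
qed

section \<open>The mild equation along a fixed path\<close>

text \<open>The exceptional set is enlarged to a Borel null set, for which the order of the variables can be
  exchanged by Fubini's theorem.\<close>

lemma AE_lborel_pair_slices:
  fixes R :: "real \<Rightarrow> 'a::euclidean_space \<Rightarrow> bool"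
  assumes "AE (t, x) in lborel. R t x"
  shows "AE t in lborel. AE x in lborel. R t x" "AE x in lborel. AE t in lborel. R t x"
proof -
  have "AE z in lborel \<Otimes>\<^sub>M lborel. R (fst z) (snd z)"
    using assms unfolding lborel_prod by (simp add: case_prod_beta)
  then obtain Z where Z: "Z \<in> sets (lborel \<Otimes>\<^sub>M lborel)" "emeasure (lborel \<Otimes>\<^sub>M lborel) Z = 0"
    "{z \<in> space (lborel \<Otimes>\<^sub>M lborel). \<not> R (fst z) (snd z)} \<subseteq> Z"
    unfolding eventually_ae_filter null_sets_def by blast
  have nZ: "AE z in lborel \<Otimes>\<^sub>M lborel. z \<notin> Z"
    using Z(1,2) by (intro AE_not_in null_setsI)
  then have 1: "AE t in lborel. AE x in lborel. (t, x) \<notin> Z"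
    by (rule lborel_pair.AE_pair)
  moreover have "{z \<in> space (lborel \<Otimes>\<^sub>M lborel). (fst z, snd z) \<notin> Z} \<in> sets (lborel \<Otimes>\<^sub>M lborel)"
    using sets.compl_sets[OF Z(1)] by (simp add: set_diff_eq)
  ultimately have 2: "AE x in lborel. AE t in lborel. (t, x) \<notin> Z"
    using lborel_pair.AE_commute[of "\<lambda>t x. (t, x) \<notin> Z"] by blast
  have R: "R t x" if "(t, x) \<notin> Z" for t x
  proof (rule ccontr)
    assume "\<not> R t x"
    then have "(t, x) \<in> {z \<in> space (lborel \<Otimes>\<^sub>M lborel). \<not> R (fst z) (snd z)}"
      by (simp add: space_pair_measure)
    with Z(3) that show False by blast
  qed
  show "AE t in lborel. AE x in lborel. R t x"
    using 1 by (rule eventually_mono) (auto elim: eventually_mono intro: R)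
  show "AE x in lborel. AE t in lborel. R t x"
    using 2 by (rule eventually_mono) (auto elim: eventually_mono intro: R)
qed

lemma AE_lborel_snd:
  fixes S :: "'a::euclidean_space \<Rightarrow> bool"
  assumes "AE x in lborel. S x"
  shows "AE (t::real, x) in lborel. S x"
proof -
  obtain Z where Z: "Z \<in> null_sets lborel" "{x. \<not> S x} \<subseteq> Z"
    using assms unfolding eventually_ae_filter by auto
  have "AE z in lborel \<Otimes>\<^sub>M lborel. snd (z :: real \<times> 'a) \<notin> Z"
  proof (rule lborel_pair.AE_pair_measure)
    show "AE t in lborel. AE x in lborel. snd (t :: real, x :: 'a) \<notin> Z"
      using AE_not_in[OF Z(1)] by simp
    have [measurable]: "Z \<in> sets borel" using Z(1) by auto
    show "{z \<in> space (lborel \<Otimes>\<^sub>M lborel). snd (z :: real \<times> 'a) \<notin> Z} \<in> sets (lborel \<Otimes>\<^sub>M lborel)"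
      by measurable
  qed
  then show ?thesis
    unfolding lborel_prod using Z(2) by (auto elim!: eventually_mono)
qed

lemma half_energy_nonneg: "0 \<le> half_energy f t s"
  unfolding half_energy_def set_lebesgue_integral_def by (simp add: integral_nonneg_AE)

text \<open>Nothing is known about \<open>f\<close> at negative times, whence the restriction to \<open>0 \<le> s\<close>. The square of \<open>f\<close>
  is Borel on the half-line as a limit of its integrable restrictions to bounded intervals.\<close>

lemma half_energy_borel:
  assumes "\<And>t. 0 \<le> t \<Longrightarrow> set_integrable lborel {0..t} (\<lambda>r. (f r)\<^sup>2)"
  obtains E where "E \<in> borel_measurable (borel \<Otimes>\<^sub>M borel)" "\<And>t s. 0 \<le> s \<Longrightarrow> half_energy f t s = E (t, s)"
proof -
  have "(\<lambda>r. indicator {0..real i} r *\<^sub>R (f r)\<^sup>2) \<in> borel_measurable lborel" for i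
    using assms[of "real i"] by (auto simp: set_integrable_def)
  moreover have "(\<lambda>i. indicator {0..real i} r *\<^sub>R (f r)\<^sup>2) \<longlonglongrightarrow> indicator {0..} r *\<^sub>R (f r)\<^sup>2" for r :: real
  proof (rule tendsto_eventually)
    show "\<forall>\<^sub>F i in sequentially. indicator {0..real i} r *\<^sub>R (f r)\<^sup>2 = indicator {0..} r *\<^sub>R (f r)\<^sup>2"
      using eventually_ge_at_top[of "nat \<lceil>r\<rceil>"] by eventually_elim (auto simp: indicator_def ceiling_le_iff nat_le_iff)
  qed
  ultimately have [measurable]: "(\<lambda>r. indicator {0..} r *\<^sub>R (f r)\<^sup>2) \<in> borel_measurable borel"
    using borel_measurable_LIMSEQ_real[where u = "\<lambda>i r. indicator {0..real i} r *\<^sub>R (f r)\<^sup>2" and M = lborel] by simp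
  let ?E = "\<lambda>(t, s). (1/2) * (\<integral>r. (if s \<le> r \<and> r \<le> t then 1 else 0) * (indicator {0..} r *\<^sub>R (f r)\<^sup>2) \<partial>lborel)"
  have "?E \<in> borel_measurable (borel \<Otimes>\<^sub>M borel)"
    by measurable
  moreover have "half_energy f t s = ?E (t, s)" if "0 \<le> s" for t s
    unfolding half_energy_def set_lebesgue_integral_def using that
    by (auto intro!: Bochner_Integration.integral_cong simp: indicator_def)
  ultimately show ?thesis using that by blast
qed

text \<open>The part of the equation that depends on \<open>v\<close>; the term with the initial value cancels when two
  functions are compared.\<close>

definition duhamel where
  "duhamel D p k a g n v x t s =
     exp (- n s - half_energy a t s) * evol D p k t s (\<lambda>y. g (exp (n s) * v y s)) x"

lemma mild_rhs_eq_duhamel: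
  "mild_rhs D p k a g \<phi> n v x t =
     exp (- half_energy a t 0) * evol D p k t 0 \<phi> x + (LINT s:{0..t}|lborel. duhamel D p k a g n v x t s)"
  by (simp add: mild_rhs_def duhamel_def)

text \<open>The mild equation for one fixed path \<open>n\<close> of the noise, which is almost surely Borel measurable
  and bounded near the initial time.\<close>

locale path_equation =
  fixes D :: "'a::euclidean_space set" and p :: "real \<Rightarrow> 'a \<Rightarrow> 'a \<Rightarrow> real"
    and k a g n :: "real \<Rightarrow> real" and \<nu> :: real
  assumes open_D: "open D"
    and p_cont: "continuous_on ({0<..} \<times> D \<times> D) (\<lambda>(t, x, y). p t x y)"
    and p_nonneg: "\<And>t x y. 0 < t \<Longrightarrow> x \<in> D \<Longrightarrow> y \<in> D \<Longrightarrow> 0 \<le> p t x y"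
    and p_mass: "\<And>t x. 0 < t \<Longrightarrow> x \<in> D \<Longrightarrow> (\<integral>\<^sup>+y\<in>D. ennreal (p t x y) \<partial>lborel) \<le> 1"
    and a_int: "\<And>t. 0 \<le> t \<Longrightarrow> set_integrable lborel {0..t} (\<lambda>r. (a r)\<^sup>2)"
    and k_int: "\<And>t. 0 \<le> t \<Longrightarrow> set_integrable lborel {0..t} (\<lambda>r. (k r)\<^sup>2)"
    and g_nonneg: "\<And>z. 0 \<le> g z"
    and g_lipschitz: "local_lipschitz (UNIV :: real set) UNIV (\<lambda>_. g)"
    and n_meas: "set_borel_measurable lborel {0..} n"
    and n_bound: "\<And>t. t \<in> {0..1} \<Longrightarrow> \<bar>n t\<bar> \<le> \<nu>"
begin

abbreviation "rhs \<equiv> \<lambda>\<phi> v x t. mild_rhs D p k a g \<phi> n v x t"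
abbreviation "duh \<equiv> duhamel D p k a g n"
abbreviation "measurable_upto T v \<equiv> set_borel_measurable lborel ({0..<T} \<times> D) (\<lambda>(t, x). v x t)"

lemma sets_D [measurable]: "D \<in> sets borel"
  using open_D by simp

lemma g_compact_lipschitz:
  obtains l where "0 < l" "\<And>y z. \<bar>y\<bar> \<le> b \<Longrightarrow> \<bar>z\<bar> \<le> b \<Longrightarrow> \<bar>g y - g z\<bar> \<le> l * \<bar>y - z\<bar>"
proof -
  have "local_lipschitz {0::real} {-b..b} (\<lambda>_. g)"
    using g_lipschitz by (rule local_lipschitz_subset) auto
  then obtain L where L: "\<And>t::real. t \<in> {0} \<Longrightarrow> L-lipschitz_on {-b..b} g"
    by (rule local_lipschitz_compact_implies_lipschitz) auto
  have "\<bar>g y - g z\<bar> \<le> max 1 L * \<bar>y - z\<bar>" if "\<bar>y\<bar> \<le> b" "\<bar>z\<bar> \<le> b" for y z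
  proof -
    have "\<bar>g y - g z\<bar> \<le> L * \<bar>y - z\<bar>"
      using lipschitz_onD[OF L[of 0], of y z] that by (auto simp: dist_real_def abs_le_iff)
    also have "\<dots> \<le> max 1 L * \<bar>y - z\<bar>"
      by (intro mult_right_mono) auto
    finally show ?thesis .
  qed
  then show ?thesis using that[of "max 1 L"] by simp
qed

lemma g_continuous: "continuous_on UNIV g"
  using local_lipschitz_continuous_on[OF g_lipschitz, of 0] by simp

lemma g_borel [measurable]: "g \<in> borel_measurable borel"
  using g_continuous by (rule borel_measurable_continuous_onI)

lemma g_bounded_on_compact:
  obtains G where "0 \<le> G" "\<And>z. \<bar>z\<bar> \<le> b \<Longrightarrow> g z \<le> G"
proof -
  obtain l where l: "0 < l" "\<And>y z. \<bar>y\<bar> \<le> \<bar>b\<bar> \<Longrightarrow> \<bar>z\<bar> \<le> \<bar>b\<bar> \<Longrightarrow> \<bar>g y - g z\<bar> \<le> l * \<bar>y - z\<bar>"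
    using g_compact_lipschitz[of "\<bar>b\<bar>"] by blast
  have "g z \<le> g 0 + l * \<bar>b\<bar>" if "\<bar>z\<bar> \<le> b" for z
  proof -
    have "\<bar>g z - g 0\<bar> \<le> l * \<bar>z - 0\<bar>"
      using that by (intro l) auto
    also have "\<dots> \<le> l * \<bar>b\<bar>"
      using l that by (intro mult_left_mono) auto
    finally show ?thesis by linarith
  qed
  then show ?thesis
    using that[of "g 0 + l * \<bar>b\<bar>"] l g_nonneg[of 0] by simp
qed

text \<open>The transition density extended by zero, so that it is Borel on the whole space and integrals over
  \<open>D\<close> become integrals over the whole space.\<close>

definition q :: "real \<Rightarrow> 'a \<Rightarrow> 'a \<Rightarrow> real" where
  "q r x y = indicator ({0<..} \<times> D \<times> D) (r, x, y) * p r x y"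

lemma q_borel: "(\<lambda>(r, x, y). q r x y) \<in> borel_measurable (borel \<Otimes>\<^sub>M (borel \<Otimes>\<^sub>M borel))"
proof -
  have "{0::real<..} \<times> D \<times> D \<in> sets borel"
    using open_D by (intro borel_open open_Times open_greaterThan)
  from borel_measurable_continuous_on_indicator[OF this p_cont]
  show ?thesis
    by (simp add: q_def borel_prod case_prod_beta')
qed

lemma q_compose_borel [measurable (raw)]:
  assumes [measurable]: "f \<in> borel_measurable N" "h \<in> borel_measurable N" "j \<in> borel_measurable N"
  shows "(\<lambda>z. q (f z) (h z) (j z)) \<in> borel_measurable N"
proof -
  have "(\<lambda>z. (f z, h z, j z)) \<in> measurable N (borel \<Otimes>\<^sub>M (borel \<Otimes>\<^sub>M borel))"
    by measurable
  from measurable_compose[OF this q_borel] show ?thesis by simp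
qed

lemma q_section_borel [measurable]: "q r x \<in> borel_measurable borel"
  by measurable

lemma q_nonneg: "0 \<le> q r x y"
  using p_nonneg by (simp add: q_def indicator_def)

lemma q_integrable: "integrable lborel (q r x)" and q_integral_le_1: "(\<integral>y. q r x y \<partial>lborel) \<le> 1"
proof -
  have "(\<integral>\<^sup>+y. ennreal (q r x y) \<partial>lborel) \<le> 1"
  proof (cases "0 < r \<and> x \<in> D")
    case True
    then have "(\<integral>\<^sup>+y. ennreal (q r x y) \<partial>lborel) = (\<integral>\<^sup>+y\<in>D. ennreal (p r x y) \<partial>lborel)"
      by (intro nn_integral_cong) (simp add: q_def indicator_def)
    then show ?thesis using p_mass True by simp
  next
    case False
    then have "q r x y = 0" for y by (auto simp: q_def)
    then show ?thesis by simp
  qed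
  then have fin: "(\<integral>\<^sup>+y. ennreal (q r x y) \<partial>lborel) \<le> ennreal 1" by simp
  then show "integrable lborel (q r x)"
    using q_nonneg by (intro integrableI_nonneg) (auto intro: le_less_trans)
  then show "(\<integral>y. q r x y \<partial>lborel) \<le> 1"
    using fin q_nonneg by (simp add: nn_integral_eq_integral)
qed

lemma evol_eq_q:
  assumes "x \<in> D"
  shows "evol D p k t s f x = (if half_energy k t s = 0 then f x else (\<integral>y. q (half_energy k t s) x y * f y \<partial>lborel))"
  unfolding evol_def set_lebesgue_integral_def using assms half_energy_nonneg[of k t s]
  by (auto intro!: Bochner_Integration.integral_cong simp: q_def indicator_def)

lemma evol_bound:
  assumes x: "x \<in> D" and f: "AE y in lborel. y \<in> D \<longrightarrow> \<bar>f y\<bar> \<le> c" "\<bar>f x\<bar> \<le> c"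
  shows "\<bar>evol D p k t s f x\<bar> \<le> c"
proof (cases "half_energy k t s = 0")
  case True
  with f show ?thesis by (simp add: evol_def)
next
  case False
  let ?r = "half_energy k t s"
  have c: "0 \<le> c" using f(2) by linarith
  have "\<bar>\<integral>y. q ?r x y * f y \<partial>lborel\<bar> \<le> (\<integral>y. \<bar>q ?r x y * f y\<bar> \<partial>lborel)"
    by (rule integral_abs_bound)
  also have "\<dots> \<le> (\<integral>y. c * q ?r x y \<partial>lborel)"
  proof (rule integral_mono_AE')
    show "AE y in lborel. \<bar>q ?r x y * f y\<bar> \<le> c * q ?r x y"
      using f(1)
    proof eventually_elim
      case (elim y)
      show ?case
      proof (cases "y \<in> D")
        case True
        with elim have "q ?r x y * \<bar>f y\<bar> \<le> q ?r x y * c"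
          using q_nonneg by (intro mult_left_mono) auto
        then show ?thesis using q_nonneg by (simp add: abs_mult mult.commute)
      qed (simp add: q_def)
    qed
  qed (use q_integrable q_nonneg c in auto)
  also have "\<dots> = c * (\<integral>y. q ?r x y \<partial>lborel)"
    by simp
  also have "\<dots> \<le> c * 1"
    using c q_integral_le_1 by (intro mult_left_mono)
  finally show ?thesis using False by (simp add: evol_eq_q[OF x])
qed

lemma evol_nonneg:
  assumes "x \<in> D" "\<And>y. y \<in> D \<Longrightarrow> 0 \<le> f y"
  shows "0 \<le> evol D p k t s f x"
proof -
  have "0 \<le> q r x y * f y" for r y
    using q_nonneg assms(2) by (cases "y \<in> D") (auto simp: q_def)
  then show ?thesis
    using assms by (simp add: evol_eq_q)
qed

lemma integrable_q_mult:
  assumes "set_borel_measurable lborel D f" and "AE y in lborel. y \<in> D \<longrightarrow> \<bar>f y\<bar> \<le> c"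
  shows "integrable lborel (\<lambda>y. q r x y * f y)"
proof (rule Bochner_Integration.integrable_bound)
  show "integrable lborel (\<lambda>y. c * q r x y)"
    using q_integrable by simp
  have [measurable]: "(\<lambda>y. indicator D y *\<^sub>R f y) \<in> borel_measurable borel"
    using assms(1) by (simp add: set_borel_measurable_def)
  have "(\<lambda>y. q r x y * f y) = (\<lambda>y. q r x y * (indicator D y *\<^sub>R f y))"
    by (auto simp: fun_eq_iff q_def indicator_def)
  moreover have "(\<lambda>y. q r x y * (indicator D y *\<^sub>R f y)) \<in> borel_measurable lborel"
    by measurable
  ultimately show "(\<lambda>y. q r x y * f y) \<in> borel_measurable lborel"
    by simp
  show "AE y in lborel. norm (q r x y * f y) \<le> norm (c * q r x y)"
    using assms(2)
  proof eventually_elim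
    case (elim y)
    show ?case
    proof (cases "y \<in> D")
      case True
      with elim have "q r x y * \<bar>f y\<bar> \<le> q r x y * \<bar>c\<bar>"
        using q_nonneg by (intro mult_left_mono) auto
      then show ?thesis using q_nonneg[of r x y] by (simp add: abs_mult mult.commute)
    qed (simp add: q_def)
  qed
qed

lemma evol_diff:
  assumes "x \<in> D" and "set_borel_measurable lborel D f" "AE y in lborel. y \<in> D \<longrightarrow> \<bar>f y\<bar> \<le> b"
    and "set_borel_measurable lborel D h" "AE y in lborel. y \<in> D \<longrightarrow> \<bar>h y\<bar> \<le> b"
  shows "evol D p k t s f x - evol D p k t s h x = evol D p k t s (\<lambda>y. f y - h y) x"
  using integrable_q_mult[OF assms(2,3)] integrable_q_mult[OF assms(4,5)] assms(1)
  by (simp add: evol_eq_q right_diff_distrib)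


text \<open>The integrand agrees with a Borel function of all its variables on the relevant range, and is otherwise
  arbitrary: \<open>v\<close>, \<open>n\<close> and the energies carry no information outside it. Measurability of the right-hand side
  of the equation, and of each of its time integrands, follows by taking sections and integrals.\<close>

lemma duhamel_borel:
  assumes T: "0 < T" and v: "measurable_upto T v"
  obtains J where "J \<in> borel_measurable ((borel \<Otimes>\<^sub>M borel) \<Otimes>\<^sub>M borel)"
    "\<And>t x s. 0 \<le> s \<Longrightarrow> s < T \<Longrightarrow> x \<in> D \<Longrightarrow> duh v x t s = J ((t, x), s)"
proof -
  obtain A where A [measurable]: "A \<in> borel_measurable (borel \<Otimes>\<^sub>M borel)" and A_eq: "\<And>t s. 0 \<le> s \<Longrightarrow> half_energy a t s = A (t, s)"
    using half_energy_borel[OF a_int] by blast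
  obtain K where K [measurable]: "K \<in> borel_measurable (borel \<Otimes>\<^sub>M borel)" and K_eq: "\<And>t s. 0 \<le> s \<Longrightarrow> half_energy k t s = K (t, s)"
    using half_energy_borel[OF k_int] by blast
  define V where "V z = indicator ({0..<T} \<times> D) z *\<^sub>R (case z of (t, x) \<Rightarrow> v x t)" for z
  have [measurable]: "V \<in> borel_measurable (borel \<Otimes>\<^sub>M borel)"
    using v unfolding set_borel_measurable_def V_def[abs_def] borel_prod by simp
  define \<eta> where "\<eta> s = indicator {0..} s *\<^sub>R n s" for s
  have [measurable]: "\<eta> \<in> borel_measurable borel"
    using n_meas by (simp add: set_borel_measurable_def \<eta>_def[abs_def])
  define J where "J = (\<lambda>z. case (fst (fst z), snd (fst z), snd z) of (t, x, s) \<Rightarrow> exp (- \<eta> s - A (t, s)) *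
     (if K (t, s) = 0 then g (exp (\<eta> s) * V (s, x))
      else (\<integral>y. q (K (t, s)) x y * g (exp (\<eta> s) * V (s, y)) \<partial>lborel)))"
  have "J \<in> borel_measurable ((borel \<Otimes>\<^sub>M borel) \<Otimes>\<^sub>M borel)"
    unfolding J_def prod.case by measurable
  moreover have "duh v x t s = J ((t, x), s)" if s: "0 \<le> s" "s < T" and x: "x \<in> D" for t x s
  proof -
    have q: "q r x y * g (exp (n s) * v y s) = q r x y * g (exp (n s) * V (s, y))" for r y
      using s by (cases "y \<in> D") (auto simp: q_def V_def)
    show ?thesis
      using s x unfolding duhamel_def evol_eq_q[OF x] J_def q by (simp add: A_eq K_eq \<eta>_def V_def)
  qed
  ultimately show ?thesis using that by blast
qed

lemma duhamel_measurable:
  assumes "measurable_upto T v" "x \<in> D" "t < T"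
  shows "set_borel_measurable lborel {0..t} (duh v x t)"
proof (cases "0 \<le> t")
  case True
  then have T: "0 < T" using assms by simp
  obtain J where [measurable]: "J \<in> borel_measurable ((borel \<Otimes>\<^sub>M borel) \<Otimes>\<^sub>M borel)"
    and J: "\<And>t x s. 0 \<le> s \<Longrightarrow> s < T \<Longrightarrow> x \<in> D \<Longrightarrow> duh v x t s = J ((t, x), s)"
    using duhamel_borel[OF T assms(1)] by blast
  have "(\<lambda>s. indicator {0..t} s *\<^sub>R J ((t, x), s)) \<in> borel_measurable borel"
    by measurable
  also have "(\<lambda>s. indicator {0..t} s *\<^sub>R J ((t, x), s)) = (\<lambda>s. indicator {0..t} s *\<^sub>R duh v x t s)"
    using J assms by (auto simp: fun_eq_iff indicator_def)
  finally show ?thesis by (simp add: set_borel_measurable_def)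
qed (simp add: set_borel_measurable_def)

lemma rhs_measurable:
  assumes \<phi>: "set_borel_measurable lborel D \<phi>" and T: "0 < T" and v: "measurable_upto T v"
  shows "measurable_upto T (rhs \<phi> v)"
proof -
  obtain J where [measurable]: "J \<in> borel_measurable ((borel \<Otimes>\<^sub>M borel) \<Otimes>\<^sub>M borel)"
    and J: "\<And>t x s. 0 \<le> s \<Longrightarrow> s < T \<Longrightarrow> x \<in> D \<Longrightarrow> duh v x t s = J ((t, x), s)"
    using duhamel_borel[OF T v] by blast
  obtain A where A [measurable]: "A \<in> borel_measurable (borel \<Otimes>\<^sub>M borel)" and A_eq: "\<And>t s. 0 \<le> s \<Longrightarrow> half_energy a t s = A (t, s)"
    using half_energy_borel[OF a_int] by blast
  obtain K where K [measurable]: "K \<in> borel_measurable (borel \<Otimes>\<^sub>M borel)" and K_eq: "\<And>t s. 0 \<le> s \<Longrightarrow> half_energy k t s = K (t, s)"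
    using half_energy_borel[OF k_int] by blast
  define \<Phi> where "\<Phi> x = indicator D x *\<^sub>R \<phi> x" for x
  have [measurable]: "\<Phi> \<in> borel_measurable borel"
    using \<phi> by (simp add: set_borel_measurable_def \<Phi>_def[abs_def])
  have [measurable]: "{0..<T} \<times> D \<in> sets (borel \<Otimes>\<^sub>M borel)"
    by (intro pair_measureI) auto
  define R where "R = (\<lambda>(t, x). exp (- A (t, 0)) *
      (if K (t, 0) = 0 then \<Phi> x else (\<integral>y. q (K (t, 0)) x y * \<Phi> y \<partial>lborel)) +
      (\<integral>s. (if 0 \<le> s \<and> s \<le> t then 1 else 0) *\<^sub>R J ((t, x), s) \<partial>lborel))"
  have [measurable]: "R \<in> borel_measurable (borel \<Otimes>\<^sub>M borel)"
    unfolding R_def by measurable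
  have "(\<lambda>z. indicator ({0..<T} \<times> D) z *\<^sub>R R z) \<in> borel_measurable (borel \<Otimes>\<^sub>M borel)"
    by measurable
  also have "(\<lambda>z. indicator ({0..<T} \<times> D) z *\<^sub>R R z)
      = (\<lambda>z. indicator ({0..<T} \<times> D) z *\<^sub>R (case z of (t, x) \<Rightarrow> rhs \<phi> v x t))"
  proof
    fix z :: "real \<times> 'a"
    obtain t x where z: "z = (t, x)" by fastforce
    have "R (t, x) = rhs \<phi> v x t" if t: "0 \<le> t" "t < T" and x: "x \<in> D"
    proof -
      have q: "q r x y * \<phi> y = q r x y * \<Phi> y" for r y
        by (cases "y \<in> D") (auto simp: q_def \<Phi>_def)
      have "(LINT s:{0..t}|lborel. duh v x t s) = (\<integral>s. (if 0 \<le> s \<and> s \<le> t then 1 else 0) *\<^sub>R J ((t, x), s) \<partial>lborel)"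
        unfolding set_lebesgue_integral_def using t x J
        by (intro Bochner_Integration.integral_cong) (auto simp: indicator_def)
      then show ?thesis
        using x by (simp add: mild_rhs_eq_duhamel evol_eq_q[OF x] q R_def A_eq K_eq \<Phi>_def)
    qed
    then show "indicator ({0..<T} \<times> D) z *\<^sub>R R z = indicator ({0..<T} \<times> D) z *\<^sub>R (case z of (t, x) \<Rightarrow> rhs \<phi> v x t)"
      by (auto simp: z indicator_def)
  qed
  finally show ?thesis
    by (simp add: set_borel_measurable_def borel_prod)
qed

lemma measurable_upto_section:
  assumes "measurable_upto T v" "s \<in> {0..<T}"
  shows "set_borel_measurable lborel D (\<lambda>y. v y s)"
proof -
  have [measurable]: "(\<lambda>z. indicator ({0..<T} \<times> D) z *\<^sub>R (case z of (t, x) \<Rightarrow> v x t)) \<in> borel_measurable (borel \<Otimes>\<^sub>M borel)"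
    using assms(1) by (simp add: set_borel_measurable_def borel_prod)
  have "(\<lambda>y. indicator ({0..<T} \<times> D) (s, y) *\<^sub>R (case (s, y) of (t, x) \<Rightarrow> v x t)) \<in> borel_measurable borel"
    by (rule measurable_compose[of "\<lambda>y. (s, y)", rotated]) measurable
  also have "(\<lambda>y. indicator ({0..<T} \<times> D) (s, y) *\<^sub>R (case (s, y) of (t, x) \<Rightarrow> v x t)) = (\<lambda>y. indicator D y *\<^sub>R v y s)"
    using assms(2) by (auto simp: fun_eq_iff indicator_def)
  finally show ?thesis by (simp add: set_borel_measurable_def)
qed

lemma reaction_measurable:
  assumes "measurable_upto T v" "s \<in> {0..<T}"
  shows "set_borel_measurable lborel D (\<lambda>y. g (c * v y s))"
proof -
  have [measurable]: "(\<lambda>y. indicator D y *\<^sub>R v y s) \<in> borel_measurable borel"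
    using measurable_upto_section[OF assms] by (simp add: set_borel_measurable_def)
  have "(\<lambda>y. indicator D y *\<^sub>R g (c * (indicator D y *\<^sub>R v y s))) \<in> borel_measurable borel"
    by measurable
  also have "(\<lambda>y. indicator D y *\<^sub>R g (c * (indicator D y *\<^sub>R v y s))) = (\<lambda>y. indicator D y *\<^sub>R g (c * v y s))"
    by (auto simp: fun_eq_iff indicator_def)
  finally show ?thesis by (simp add: set_borel_measurable_def)
qed

lemma exp_factor_le:
  assumes "s \<in> {0..1}"
  shows "exp (- n s - half_energy a t s) \<le> exp \<nu>"
  using n_bound[OF assms] half_energy_nonneg[of a t s] by simp

lemma exp_mult_le:
  assumes "s \<in> {0..1}" "\<bar>z\<bar> \<le> m"
  shows "\<bar>exp (n s) * z\<bar> \<le> exp \<nu> * m"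
  unfolding abs_mult abs_exp_cancel using n_bound[OF assms(1)] assms(2) by (intro mult_mono) auto

lemma duhamel_bound:
  assumes x: "x \<in> D" and s: "s \<in> {0..1}" and G: "\<And>z. \<bar>z\<bar> \<le> exp \<nu> * m \<Longrightarrow> g z \<le> G"
    and v: "AE y in lborel. y \<in> D \<longrightarrow> \<bar>v y s\<bar> \<le> m" "\<bar>v x s\<bar> \<le> m"
  shows "\<bar>duh v x t s\<bar> \<le> exp \<nu> * G"
proof -
  have gv: "\<bar>g (exp (n s) * v y s)\<bar> \<le> G" if "\<bar>v y s\<bar> \<le> m" for y
    using G[OF exp_mult_le[OF s that]] g_nonneg by simp
  have "AE y in lborel. y \<in> D \<longrightarrow> \<bar>g (exp (n s) * v y s)\<bar> \<le> G"
    using v(1) by eventually_elim (auto intro: gv)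
  then have "\<bar>evol D p k t s (\<lambda>y. g (exp (n s) * v y s)) x\<bar> \<le> G"
    using v(2) by (intro evol_bound[OF x] gv)
  then show ?thesis
    unfolding duhamel_def abs_mult abs_exp_cancel using exp_factor_le[OF s] by (intro mult_mono) auto
qed

text \<open>The evolution is linear and does not increase bounds, so the estimate reduces to the Lipschitz bound
  for \<open>g\<close>; each of the two exponential factors of the noise contributes \<open>e\<^sup>\<nu>\<close>. Closeness at the
  point \<open>x\<close> itself is needed for the case that the evolution is the identity.\<close>

lemma duhamel_diff_bound:
  assumes x: "x \<in> D" and s: "s \<in> {0..<T}" "T \<le> 1"
    and vw: "measurable_upto T v" "measurable_upto T w"
    and l: "0 \<le> l" "\<And>y z. \<bar>y\<bar> \<le> exp \<nu> * m \<Longrightarrow> \<bar>z\<bar> \<le> exp \<nu> * m \<Longrightarrow> \<bar>g y - g z\<bar> \<le> l * \<bar>y - z\<bar>"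
    and ae: "AE y in lborel. y \<in> D \<longrightarrow> \<bar>v y s\<bar> \<le> m \<and> \<bar>w y s\<bar> \<le> m \<and> \<bar>v y s - w y s\<bar> \<le> \<epsilon>"
    and at: "\<bar>v x s\<bar> \<le> m \<and> \<bar>w x s\<bar> \<le> m \<and> \<bar>v x s - w x s\<bar> \<le> \<epsilon>"
  shows "\<bar>duh v x t s - duh w x t s\<bar> \<le> exp \<nu> * (l * (exp \<nu> * \<epsilon>))"
proof -
  have s1: "s \<in> {0..1}" using s by auto
  obtain G where G: "\<And>z. \<bar>z\<bar> \<le> exp \<nu> * m \<Longrightarrow> g z \<le> G"
    using g_bounded_on_compact[of "exp \<nu> * m"] by blast
  have gG: "\<bar>g (exp (n s) * z)\<bar> \<le> G" if "\<bar>z\<bar> \<le> m" for z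
    using G[OF exp_mult_le[OF s1 that]] g_nonneg by simp
  have gl: "\<bar>g (exp (n s) * v y s) - g (exp (n s) * w y s)\<bar> \<le> l * (exp \<nu> * \<epsilon>)"
    if "\<bar>v y s\<bar> \<le> m \<and> \<bar>w y s\<bar> \<le> m \<and> \<bar>v y s - w y s\<bar> \<le> \<epsilon>" for y
  proof -
    have "\<bar>g (exp (n s) * v y s) - g (exp (n s) * w y s)\<bar> \<le> l * \<bar>exp (n s) * v y s - exp (n s) * w y s\<bar>"
      using that by (intro l exp_mult_le s1) auto
    also have "\<dots> = l * \<bar>exp (n s) * (v y s - w y s)\<bar>"
      by (simp add: right_diff_distrib)
    also have "\<dots> \<le> l * (exp \<nu> * \<epsilon>)"
      using that l by (intro mult_left_mono exp_mult_le s1) auto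
    finally show ?thesis .
  qed
  have "AE y in lborel. y \<in> D \<longrightarrow> \<bar>g (exp (n s) * v y s)\<bar> \<le> G"
    using ae by eventually_elim (auto intro: gG)
  moreover have "AE y in lborel. y \<in> D \<longrightarrow> \<bar>g (exp (n s) * w y s)\<bar> \<le> G"
    using ae by eventually_elim (auto intro: gG)
  ultimately have "duh v x t s - duh w x t s = exp (- n s - half_energy a t s) *
      evol D p k t s (\<lambda>y. g (exp (n s) * v y s) - g (exp (n s) * w y s)) x"
    using evol_diff[OF x reaction_measurable[OF vw(1) s(1)] _ reaction_measurable[OF vw(2) s(1)]]
    by (simp add: duhamel_def right_diff_distrib[symmetric])
  moreover have "\<bar>evol D p k t s (\<lambda>y. g (exp (n s) * v y s) - g (exp (n s) * w y s)) x\<bar> \<le> l * (exp \<nu> * \<epsilon>)"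
  proof (rule evol_bound[OF x])
    show "AE y in lborel. y \<in> D \<longrightarrow> \<bar>g (exp (n s) * v y s) - g (exp (n s) * w y s)\<bar> \<le> l * (exp \<nu> * \<epsilon>)"
      using ae by eventually_elim (auto intro!: gl)
  qed (rule gl[OF at])
  ultimately show ?thesis
    using exp_factor_le[OF s1] by (simp only: abs_mult abs_exp_cancel) (intro mult_mono; simp)
qed


text \<open>The exponential weight makes the operator of the mild equation contract on any time interval
  inside \<open>[0, 1]\<close>, however large its Lipschitz constant.\<close>

definition close_at :: "real \<Rightarrow> real \<Rightarrow> real \<Rightarrow> ('a \<Rightarrow> real \<Rightarrow> real) \<Rightarrow> ('a \<Rightarrow> real \<Rightarrow> real) \<Rightarrow> real \<Rightarrow> 'a \<Rightarrow> bool" where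
  "close_at m lam c v w s y \<longleftrightarrow>
     \<bar>v y s\<bar> \<le> m \<and> \<bar>w y s\<bar> \<le> m \<and> \<bar>v y s - w y s\<bar> \<le> c * exp (lam * s)"

text \<open>With \<open>\<Lambda>\<close> the Lipschitz constant of the integrand and \<open>\<lambda> = 2 \<Lambda>\<close>, integrating
  \<open>\<Lambda> c e\<^sup>\<lambda>\<^sup>s\<close> over \<open>[0, t]\<close> gives at most \<open>(c / 2) e\<^sup>\<lambda>\<^sup>t\<close>. The weight depends on the bound \<open>m\<close> only, so it can be
  fixed before the functions that are compared.\<close>

lemma rhs_weighted_contraction:
  obtains lam where "0 < lam"
    "\<And>T v w c x t \<phi>. T \<le> 1 \<Longrightarrow> measurable_upto T v \<Longrightarrow> measurable_upto T w \<Longrightarrow> 0 \<le> c \<Longrightarrow>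
       x \<in> D \<Longrightarrow> t \<in> {0..<T} \<Longrightarrow>
       AE s in lborel. s \<in> {0..<T} \<longrightarrow> (AE y in lborel. y \<in> D \<longrightarrow> close_at m lam c v w s y) \<Longrightarrow>
       AE s in lborel. s \<in> {0..<T} \<longrightarrow> close_at m lam c v w s x \<Longrightarrow>
       \<bar>rhs \<phi> v x t - rhs \<phi> w x t\<bar> \<le> c / 2 * exp (lam * t)"
proof -
  obtain l where l: "0 < l" "\<And>y z. \<bar>y\<bar> \<le> exp \<nu> * m \<Longrightarrow> \<bar>z\<bar> \<le> exp \<nu> * m \<Longrightarrow> \<bar>g y - g z\<bar> \<le> l * \<bar>y - z\<bar>"
    using g_compact_lipschitz[of "exp \<nu> * m"] by blast
  obtain G where G: "\<And>z. \<bar>z\<bar> \<le> exp \<nu> * m \<Longrightarrow> g z \<le> G"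
    using g_bounded_on_compact[of "exp \<nu> * m"] by blast
  define lam where "lam = 2 * (exp \<nu> * (l * exp \<nu>))"
  have lam: "0 < lam" using l by (simp add: lam_def)
  show ?thesis
  proof (rule that[OF lam])
    fix T :: real and v w :: "'a \<Rightarrow> real \<Rightarrow> real" and c :: real and x :: 'a and t :: real and \<phi> :: "'a \<Rightarrow> real"
    assume T: "T \<le> 1" and vw: "measurable_upto T v" "measurable_upto T w" and c: "0 \<le> c"
      and x: "x \<in> D" and t: "t \<in> {0..<T}"
      and ae: "AE s in lborel. s \<in> {0..<T} \<longrightarrow> (AE y in lborel. y \<in> D \<longrightarrow> close_at m lam c v w s y)"
      and at: "AE s in lborel. s \<in> {0..<T} \<longrightarrow> close_at m lam c v w s x"
    have const: "set_integrable lborel {0..t} (\<lambda>s. exp \<nu> * G)"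
      by (intro borel_integrable_atLeastAtMost' continuous_intros)
    have integrable: "set_integrable lborel {0..t} (duh u x t)"
      if u: "measurable_upto T u" "\<And>s y. close_at m lam c v w s y \<Longrightarrow> \<bar>u y s\<bar> \<le> m" for u
    proof (rule set_integrable_bound[OF const duhamel_measurable[OF u(1) x]])
      show "AE s in lborel. s \<in> {0..t} \<longrightarrow> norm (duh u x t s) \<le> norm (exp \<nu> * G)"
        using ae at
      proof eventually_elim
        case (elim s)
        show ?case
        proof
          assume "s \<in> {0..t}"
          with t T elim have s: "s \<in> {0..1}" and 1: "AE y in lborel. y \<in> D \<longrightarrow> close_at m lam c v w s y"
            and 2: "close_at m lam c v w s x"
            by auto
          have "AE y in lborel. y \<in> D \<longrightarrow> \<bar>u y s\<bar> \<le> m"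
            using 1 by eventually_elim (auto intro: u(2))
          then have "\<bar>duh u x t s\<bar> \<le> exp \<nu> * G"
            using u(2)[OF 2] by (intro duhamel_bound[OF x s G])
          then show "norm (duh u x t s) \<le> norm (exp \<nu> * G)"
            by simp
        qed
      qed
    qed (use t in auto)
    have int: "set_integrable lborel {0..t} (duh v x t)" "set_integrable lborel {0..t} (duh w x t)"
      using vw by (auto intro!: integrable simp: close_at_def)
    have "\<bar>rhs \<phi> v x t - rhs \<phi> w x t\<bar> = \<bar>LINT s:{0..t}|lborel. duh v x t s - duh w x t s\<bar>"
      using int by (simp add: mild_rhs_eq_duhamel)
    also have "\<dots> \<le> (LINT s:{0..t}|lborel. c / 2 * (lam * exp (lam * s)))"
    proof (rule abs_set_integral_le)
      show "set_integrable lborel {0..t} (\<lambda>s. c / 2 * (lam * exp (lam * s)))"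
        by (intro borel_integrable_atLeastAtMost' continuous_intros)
      show "AE s in lborel. s \<in> {0..t} \<longrightarrow> \<bar>duh v x t s - duh w x t s\<bar> \<le> c / 2 * (lam * exp (lam * s))"
        using ae at
      proof eventually_elim
        case (elim s)
        show ?case
        proof
          assume "s \<in> {0..t}"
          with t elim have s: "s \<in> {0..<T}" and 1: "AE y in lborel. y \<in> D \<longrightarrow> close_at m lam c v w s y" and 2: "close_at m lam c v w s x"
            by auto
          have "\<bar>duh v x t s - duh w x t s\<bar> \<le> exp \<nu> * (l * (exp \<nu> * (c * exp (lam * s))))"
            by (rule duhamel_diff_bound[OF x s T vw less_imp_le[OF l(1)] l(2)
                  1[unfolded close_at_def] 2[unfolded close_at_def]])
          then show "\<bar>duh v x t s - duh w x t s\<bar> \<le> c / 2 * (lam * exp (lam * s))"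
            by (simp add: lam_def ac_simps)
        qed
      qed
    qed
    also have "\<dots> = c / 2 * exp (lam * t) - c / 2 * exp (lam * 0)"
      unfolding set_lebesgue_integral_def
    proof (rule integral_FTC_atLeastAtMost)
      show "((\<lambda>s. c / 2 * exp (lam * s)) has_vector_derivative c / 2 * (lam * exp (lam * s))) (at s within {0..t})" for s
        unfolding has_real_derivative_iff_has_vector_derivative[symmetric]
        by (auto intro!: derivative_eq_intros)
    qed (use t in \<open>auto intro!: continuous_intros\<close>)
    also have "\<dots> \<le> c / 2 * exp (lam * t)"
      using c by simp
    finally show "\<bar>rhs \<phi> v x t - rhs \<phi> w x t\<bar> \<le> c / 2 * exp (lam * t)" .
  qed
qed

text \<open>The evolution keeps the initial value between \<open>0\<close> and \<open>c\<close>, while the Duhamel term is non-negative and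
  at most \<open>T e\<^sup>\<nu> G \<le> 1\<close>.\<close>

lemma rhs_invariant_box:
  assumes \<phi>: "\<And>x. x \<in> D \<Longrightarrow> 0 \<le> \<phi> x \<and> \<phi> x \<le> c" and T: "T \<le> 1" "T * (exp \<nu> * G) \<le> 1"
    and G: "0 \<le> G" "\<And>z. \<bar>z\<bar> \<le> exp \<nu> * (c + 1) \<Longrightarrow> g z \<le> G"
    and v: "\<And>y s. y \<in> D \<Longrightarrow> s \<in> {0..<T} \<Longrightarrow> 0 \<le> v y s \<and> v y s \<le> c + 1"
    and x: "x \<in> D" and t: "t \<in> {0..<T}"
  shows "0 \<le> rhs \<phi> v x t \<and> rhs \<phi> v x t \<le> c + 1"
proof -
  have U: "0 \<le> evol D p k t 0 \<phi> x" "\<bar>evol D p k t 0 \<phi> x\<bar> \<le> c"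
    using \<phi> x by (auto intro!: evol_nonneg evol_bound AE_I2)
  have "exp (- half_energy a t 0) * evol D p k t 0 \<phi> x \<le> 1 * c"
    using U half_energy_nonneg[of a t 0] by (intro mult_mono) auto
  moreover have "0 \<le> exp (- half_energy a t 0) * evol D p k t 0 \<phi> x"
    using U by simp
  moreover have "0 \<le> (LINT s:{0..t}|lborel. duh v x t s)"
    unfolding set_lebesgue_integral_def duhamel_def using evol_nonneg[OF x] g_nonneg
    by (intro integral_nonneg_AE AE_I2) simp
  moreover have "\<bar>LINT s:{0..t}|lborel. duh v x t s\<bar> \<le> (LINT s:{0..t}|lborel. exp \<nu> * G)"
  proof (rule abs_set_integral_le)
    show "set_integrable lborel {0..t} (\<lambda>s. exp \<nu> * G)"
      by (intro borel_integrable_atLeastAtMost' continuous_intros)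
    show "AE s in lborel. s \<in> {0..t} \<longrightarrow> \<bar>duh v x t s\<bar> \<le> exp \<nu> * G"
    proof (intro AE_I2 impI)
      fix s assume "s \<in> {0..t}"
      with t T have s: "s \<in> {0..1}" "s \<in> {0..<T}" by auto
      have "\<bar>v y s\<bar> \<le> c + 1" if "y \<in> D" for y
        using v[OF that s(2)] by simp
      then show "\<bar>duh v x t s\<bar> \<le> exp \<nu> * G"
        using x by (intro duhamel_bound[OF x s(1) G(2)]) auto
    qed
  qed
  moreover have "(LINT s:{0..t}|lborel. exp \<nu> * G) = t * (exp \<nu> * G)"
    using t by (simp add: set_lebesgue_integral_def)
  moreover have "t * (exp \<nu> * G) \<le> T * (exp \<nu> * G)"
    using t G by (intro mult_right_mono) auto
  ultimately show ?thesis
    using T(2) unfolding mild_rhs_eq_duhamel by linarith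
qed


text \<open>Two solutions have a common bound \<open>m\<close>, hence weighted distance at most \<open>2 m\<close>; each application of
  the equation halves this distance.\<close>

lemma nonneg_solution_unique:
  assumes T: "T \<le> 1" and v: "nonneg_mild_solution D p k a g \<phi> n T v" and w: "nonneg_mild_solution D p k a g \<phi> n T w"
  shows "AE (t, x) in lborel. (t, x) \<in> {0..<T} \<times> D \<longrightarrow> v x t = w x t"
proof -
  have meas: "measurable_upto T v" "measurable_upto T w"
    using v w by (auto simp: nonneg_mild_solution_def Linf_on_def)
  obtain m\<^sub>v where mv: "AE (t, x) in lborel. (t, x) \<in> {0..<T} \<times> D \<longrightarrow> \<bar>v x t\<bar> \<le> m\<^sub>v"
    using v unfolding nonneg_mild_solution_def Linf_on_def case_prod_beta' prod.collapse by blast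
  obtain m\<^sub>w where mw: "AE (t, x) in lborel. (t, x) \<in> {0..<T} \<times> D \<longrightarrow> \<bar>w x t\<bar> \<le> m\<^sub>w"
    using w unfolding nonneg_mild_solution_def Linf_on_def case_prod_beta' prod.collapse by blast
  define m where "m = max 0 (max m\<^sub>v m\<^sub>w)"
  have m: "0 \<le> m" by (simp add: m_def)
  obtain lam where lam: "0 < lam" and contract:
    "\<And>T v w c x t \<phi>. T \<le> 1 \<Longrightarrow> measurable_upto T v \<Longrightarrow> measurable_upto T w \<Longrightarrow> 0 \<le> c \<Longrightarrow>
       x \<in> D \<Longrightarrow> t \<in> {0..<T} \<Longrightarrow>
       AE s in lborel. s \<in> {0..<T} \<longrightarrow> (AE y in lborel. y \<in> D \<longrightarrow> close_at m lam c v w s y) \<Longrightarrow>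
       AE s in lborel. s \<in> {0..<T} \<longrightarrow> close_at m lam c v w s x \<Longrightarrow>
       \<bar>rhs \<phi> v x t - rhs \<phi> w x t\<bar> \<le> c / 2 * exp (lam * t)"
    using rhs_weighted_contraction[of m] by blast
  have v_eq: "AE (t, x) in lborel. (t, x) \<in> {0..<T} \<times> D \<longrightarrow> v x t = rhs \<phi> v x t"
    and w_eq: "AE (t, x) in lborel. (t, x) \<in> {0..<T} \<times> D \<longrightarrow> w x t = rhs \<phi> w x t"
    using v w by (auto simp: nonneg_mild_solution_def)
  have close: "AE (t, x) in lborel. (t, x) \<in> {0..<T} \<times> D \<longrightarrow> close_at m lam (2 * m * (1/2) ^ j) v w t x" for j
  proof (induction j)
    case 0
    show ?case
      using mv mw
    proof eventually_elim
      case (elim z)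
      obtain t x where z: "z = (t, x)" by fastforce
      show ?case
        unfolding z prod.case
      proof
        assume tx: "(t, x) \<in> {0..<T} \<times> D"
        then have b: "\<bar>v x t\<bar> \<le> m" "\<bar>w x t\<bar> \<le> m"
          using elim by (auto simp: z m_def)
        have "2 * m * 1 \<le> 2 * m * exp (lam * t)"
          using m lam tx by (intro mult_left_mono) auto
        with b show "close_at m lam (2 * m * (1/2) ^ 0) v w t x"
          by (auto simp: close_at_def)
      qed
    qed
  next
    case (Suc j)
    let ?c = "2 * m * (1/2) ^ j"
    have c: "0 \<le> ?c" using m by simp
    have slices: "AE s in lborel. s \<in> {0..<T} \<longrightarrow> (AE y in lborel. y \<in> D \<longrightarrow> close_at m lam ?c v w s y)"
      using AE_lborel_pair_slices(1)[OF Suc.IH]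
      by eventually_elim (auto elim: eventually_mono)
    have "AE x in lborel. x \<in> D \<longrightarrow> (AE s in lborel. s \<in> {0..<T} \<longrightarrow> close_at m lam ?c v w s x)"
      using AE_lborel_pair_slices(2)[OF Suc.IH]
      by eventually_elim (auto elim: eventually_mono)
    then have "AE (t::real, x) in lborel. x \<in> D \<longrightarrow> (AE s in lborel. s \<in> {0..<T} \<longrightarrow> close_at m lam ?c v w s x)"
      by (rule AE_lborel_snd)
    then show ?case
      using v_eq w_eq Suc.IH
    proof eventually_elim
      case (elim z)
      obtain t x where z: "z = (t, x)" by fastforce
      show ?case
        unfolding z prod.case
      proof
        assume tx: "(t, x) \<in> {0..<T} \<times> D"
        then have "\<bar>rhs \<phi> v x t - rhs \<phi> w x t\<bar> \<le> ?c / 2 * exp (lam * t)"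
          using elim(1) by (intro contract[OF T meas c _ _ slices]) (auto simp: z)
        then show "close_at m lam (2 * m * (1/2) ^ Suc j) v w t x"
          using elim tx by (auto simp: z close_at_def)
      qed
    qed
  qed
  then have "AE z in lborel. \<forall>j. case z of (t, x) \<Rightarrow> (t, x) \<in> {0..<T} \<times> D \<longrightarrow> close_at m lam (2 * m * (1/2) ^ j) v w t x"
    by (subst AE_all_countable) simp
  then show ?thesis
  proof eventually_elim
    case (elim z)
    obtain t x where z: "z = (t, x)" by fastforce
    show ?case
      unfolding z prod.case
    proof
      assume tx: "(t, x) \<in> {0..<T} \<times> D"
      have lim: "(\<lambda>j. 2 * m * (1/2) ^ j * exp (lam * t)) \<longlonglongrightarrow> 2 * m * 0 * exp (lam * t)"
        by (intro tendsto_intros LIMSEQ_power_zero) simp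
      have "\<bar>v x t - w x t\<bar> \<le> 2 * m * (1/2) ^ j * exp (lam * t)" for j
        using elim tx by (auto simp: z close_at_def)
      then have "\<bar>v x t - w x t\<bar> \<le> 2 * m * 0 * exp (lam * t)"
        by (intro LIMSEQ_le_const[OF lim]) blast
      then show "v x t = w x t" by simp
    qed
  qed
qed

text \<open>Equality at \<open>x\<close> is needed separately, since the evolution may be the identity.\<close>

lemma rhs_cong_initial:
  assumes \<phi>: "set_borel_measurable lborel D \<phi>" "set_borel_measurable lborel D \<phi>'"
    and eq: "AE y in lborel. y \<in> D \<longrightarrow> \<phi> y = \<phi>' y" and x: "x \<in> D" "\<phi> x = \<phi>' x"
  shows "rhs \<phi> v x t = rhs \<phi>' v x t"
proof -
  have [measurable]: "(\<lambda>y. indicator D y *\<^sub>R \<phi> y) \<in> borel_measurable borel" "(\<lambda>y. indicator D y *\<^sub>R \<phi>' y) \<in> borel_measurable borel"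
    using \<phi> by (auto simp: set_borel_measurable_def)
  have "(\<integral>y. q r x y * (indicator D y *\<^sub>R \<phi> y) \<partial>lborel) = (\<integral>y. q r x y * (indicator D y *\<^sub>R \<phi>' y) \<partial>lborel)" for r
    using eq by (intro integral_cong_AE) (measurable, auto elim!: eventually_mono simp: indicator_def)
  moreover have drop: "q r x y * (indicator D y *\<^sub>R f y) = q r x y * f y" for r y and f :: "'a \<Rightarrow> real"
    by (simp add: q_def indicator_def)
  ultimately have "(\<integral>y. q r x y * \<phi> y \<partial>lborel) = (\<integral>y. q r x y * \<phi>' y \<partial>lborel)" for r
    unfolding drop by simp
  then show ?thesis
    using x by (simp add: mild_rhs_eq_duhamel evol_eq_q)
qed

text \<open>Picard iteration from \<open>0\<close>, pointwise on \<open>[0, T[ \<times> D\<close>. The contraction estimate makes the iterates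
  converge geometrically, and the limit inherits measurability, bounds and the equation.\<close>

lemma nonneg_solution_exists:
  assumes \<phi>: "Linf_on D \<phi>" "AE x in lborel. x \<in> D \<longrightarrow> 0 \<le> \<phi> x"
  obtains T v where "0 < T" "T \<le> 1" "nonneg_mild_solution D p k a g \<phi> n T v"
proof -
  obtain c' where c': "AE x in lborel. x \<in> D \<longrightarrow> \<bar>\<phi> x\<bar> \<le> c'"
    using \<phi>(1) by (auto simp: Linf_on_def)
  define c where "c = max 0 c'"
  have c: "0 \<le> c" by (simp add: c_def)
  \<comment> \<open>A representative of the initial value that satisfies its bounds everywhere, so that the iteration
    needs no exceptional sets.\<close>
  define \<psi> where "\<psi> x = (if 0 \<le> \<phi> x \<and> \<phi> x \<le> c then \<phi> x else 0)" for x
  have \<psi>: "0 \<le> \<psi> x \<and> \<psi> x \<le> c" for x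
    using c by (simp add: \<psi>_def)
  have \<psi>_eq: "AE x in lborel. x \<in> D \<longrightarrow> \<phi> x = \<psi> x"
    using c' \<phi>(2) by eventually_elim (auto simp: \<psi>_def c_def)
  have \<phi>_meas: "set_borel_measurable lborel D \<phi>"
    using \<phi>(1) by (simp add: Linf_on_def)
  have \<psi>_meas: "set_borel_measurable lborel D \<psi>"
  proof -
    define f where "f x = indicator D x *\<^sub>R \<phi> x" for x
    have [measurable]: "f \<in> borel_measurable borel"
      using \<phi>_meas by (simp add: set_borel_measurable_def f_def[abs_def])
    have "(\<lambda>x. if 0 \<le> f x \<and> f x \<le> c then f x else 0) \<in> borel_measurable borel"
      by measurable
    also have "(\<lambda>x. if 0 \<le> f x \<and> f x \<le> c then f x else 0) = (\<lambda>x. indicator D x *\<^sub>R \<psi> x)"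
      by (auto simp: fun_eq_iff f_def \<psi>_def indicator_def)
    finally show ?thesis by (simp add: set_borel_measurable_def)
  qed
  obtain G where G: "0 \<le> G" "\<And>z. \<bar>z\<bar> \<le> exp \<nu> * (c + 1) \<Longrightarrow> g z \<le> G"
    using g_bounded_on_compact[of "exp \<nu> * (c + 1)"] by blast
  \<comment> \<open>Short enough for the Duhamel term to stay below \<open>1\<close>.\<close>
  define T where "T = 1 / (1 + exp \<nu> * G)"
  have T: "0 < T" "T \<le> 1" "T * (exp \<nu> * G) \<le> 1"
    using G(1) by (auto simp: T_def divide_le_eq add_pos_nonneg)
  obtain lam where lam: "0 < lam" and contract:
    "\<And>T v w e x t \<phi>. T \<le> 1 \<Longrightarrow> measurable_upto T v \<Longrightarrow> measurable_upto T w \<Longrightarrow> 0 \<le> e \<Longrightarrow>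
       x \<in> D \<Longrightarrow> t \<in> {0..<T} \<Longrightarrow>
       AE s in lborel. s \<in> {0..<T} \<longrightarrow> (AE y in lborel. y \<in> D \<longrightarrow> close_at (c + 1) lam e v w s y) \<Longrightarrow>
       AE s in lborel. s \<in> {0..<T} \<longrightarrow> close_at (c + 1) lam e v w s x \<Longrightarrow>
       \<bar>rhs \<phi> v x t - rhs \<phi> w x t\<bar> \<le> e / 2 * exp (lam * t)"
    using rhs_weighted_contraction[of "c + 1"] by blast
  define box where "box v \<longleftrightarrow> measurable_upto T v \<and> (\<forall>y\<in>D. \<forall>s\<in>{0..<T}. 0 \<le> v y s \<and> v y s \<le> c + 1)" for v
  have contract': "\<bar>rhs \<psi> v x t - rhs \<psi> w x t\<bar> \<le> e / 2 * exp (lam * t)"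
    if "box v" "box w" "0 \<le> e" "x \<in> D" "t \<in> {0..<T}"
      "\<And>y s. y \<in> D \<Longrightarrow> s \<in> {0..<T} \<Longrightarrow> \<bar>v y s - w y s\<bar> \<le> e * exp (lam * s)" for v w e x t
  proof -
    have "close_at (c + 1) lam e v w s y" if "y \<in> D" "s \<in> {0..<T}" for y s
      using \<open>box v\<close> \<open>box w\<close> that \<open>\<And>y s. y \<in> D \<Longrightarrow> s \<in> {0..<T} \<Longrightarrow> \<bar>v y s - w y s\<bar> \<le> e * exp (lam * s)\<close>[OF that]
      by (simp add: box_def close_at_def)
    then show ?thesis
      using that(1-5) by (intro contract[OF T(2)] AE_I2 impI) (simp_all add: box_def)
  qed
  have box_rhs: "box (rhs \<psi> v)" if "box v" for v
    unfolding box_def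
  proof (intro conjI ballI)
    show "measurable_upto T (rhs \<psi> v)"
      using that by (intro rhs_measurable \<psi>_meas T(1)) (simp add: box_def)
    fix x t assume "x \<in> D" "t \<in> {0..<T}"
    then have "0 \<le> rhs \<psi> v x t \<and> rhs \<psi> v x t \<le> c + 1"
      using that by (intro rhs_invariant_box[OF \<psi> T(2,3) G]) (auto simp: box_def)
    then show "0 \<le> rhs \<psi> v x t" "rhs \<psi> v x t \<le> c + 1" by auto
  qed
  define V where "V j = ((\<lambda>v. rhs \<psi> v) ^^ j) (\<lambda>x t. 0)" for j
  have V_Suc: "V (Suc j) = rhs \<psi> (V j)" for j
    by (simp add: V_def)
  have box_V: "box (V j)" for j
  proof (induction j)
    case 0
    then show ?case using c by (simp add: box_def V_def set_borel_measurable_def case_prod_beta')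
  next
    case (Suc j)
    then show ?case unfolding V_Suc by (rule box_rhs)
  qed
  \<comment> \<open>Induction on \<open>j\<close> applies the operator \<open>j\<close> times to the pair of \<open>V i\<close> and \<open>V 0 = 0\<close>, whose distance is at
    most \<open>c + 1\<close>; the bound is uniform in \<open>i\<close>, so it survives the limit.\<close>
  have step: "\<bar>V (i + j) x t - V j x t\<bar> \<le> (c + 1) * (1/2) ^ j * exp (lam * t)"
    if "x \<in> D" "t \<in> {0..<T}" for i j x t
    using that
  proof (induction j arbitrary: x t)
    case 0
    have "(c + 1) * 1 \<le> (c + 1) * exp (lam * t)"
      using c lam 0 by (intro mult_left_mono) auto
    moreover have "0 \<le> V i x t \<and> V i x t \<le> c + 1"
      using box_V[of i] 0 by (auto simp: box_def)
    ultimately show ?case by (simp add: V_def)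
  next
    case (Suc j)
    have "\<bar>rhs \<psi> (V (i + j)) x t - rhs \<psi> (V j) x t\<bar> \<le> (c + 1) * (1/2) ^ j / 2 * exp (lam * t)"
      using c Suc by (intro contract' box_V) auto
    then show ?case by (simp add: V_Suc)
  qed
  define u where "u x t = lim (\<lambda>j. V j x t)" for x t
  have null: "(\<lambda>j. (c + 1) * (1/2) ^ j * exp (lam * t)) \<longlonglongrightarrow> 0" for t
  proof -
    have "(\<lambda>j. (c + 1) * (1/2) ^ j * exp (lam * t)) \<longlonglongrightarrow> (c + 1) * 0 * exp (lam * t)"
      by (intro tendsto_intros LIMSEQ_power_zero) simp
    then show ?thesis by simp
  qed
  have V_lim: "(\<lambda>j. V j x t) \<longlonglongrightarrow> u x t" if xt: "x \<in> D" "t \<in> {0..<T}" for x t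
  proof -
    have "Cauchy (\<lambda>j. V j x t)"
    proof (rule CauchyI')
      fix e :: real assume "0 < e"
      then have "\<forall>\<^sub>F j in sequentially. (c + 1) * (1/2) ^ j * exp (lam * t) < e"
        using order_tendstoD(2)[OF null] by blast
      then obtain j where j: "\<And>i. j \<le> i \<Longrightarrow> (c + 1) * (1/2) ^ i * exp (lam * t) < e"
        unfolding eventually_sequentially by blast
      have "dist (V i x t) (V i' x t) < e" if "j \<le> i" "i < i'" for i i'
        using step[OF xt, of "i' - i" i] j[OF that(1)] that by (simp add: dist_real_def abs_minus_commute)
      then show "\<exists>M. \<forall>m\<ge>M. \<forall>n>m. dist (V m x t) (V n x t) < e"
        by blast
    qed
    then show ?thesis
      unfolding u_def by (simp add: Cauchy_convergent_iff convergent_LIMSEQ_iff)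
  qed
  have u_close: "\<bar>V j x t - u x t\<bar> \<le> (c + 1) * (1/2) ^ j * exp (lam * t)" if xt: "x \<in> D" "t \<in> {0..<T}" for j x t
  proof -
    have "(\<lambda>i. \<bar>V (i + j) x t - V j x t\<bar>) \<longlonglongrightarrow> \<bar>u x t - V j x t\<bar>"
      by (intro tendsto_intros LIMSEQ_ignore_initial_segment V_lim xt)
    then have "\<bar>u x t - V j x t\<bar> \<le> (c + 1) * (1/2) ^ j * exp (lam * t)"
      by (rule LIMSEQ_le_const2) (use step[OF xt] in auto)
    then show ?thesis by (simp add: abs_minus_commute)
  qed
  have u_meas: "measurable_upto T u"
    unfolding set_borel_measurable_def
  proof (rule borel_measurable_LIMSEQ_real)
    show "(\<lambda>z. indicator ({0..<T} \<times> D) z *\<^sub>R (case z of (t, x) \<Rightarrow> V j x t)) \<in> borel_measurable lborel" for j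
      using box_V[of j] by (simp add: box_def set_borel_measurable_def)
    show "(\<lambda>j. indicator ({0..<T} \<times> D) z *\<^sub>R (case z of (t, x) \<Rightarrow> V j x t)) \<longlonglongrightarrow> indicator ({0..<T} \<times> D) z *\<^sub>R (case z of (t, x) \<Rightarrow> u x t)" for z
      using V_lim by (cases z) (auto simp: indicator_def)
  qed
  have box_u: "box u"
    unfolding box_def
  proof (intro conjI ballI u_meas)
    fix x t assume xt: "x \<in> D" "t \<in> {0..<T}"
    have "0 \<le> V j x t" "V j x t \<le> c + 1" for j
      using box_V[of j] xt by (auto simp: box_def)
    then show "0 \<le> u x t" "u x t \<le> c + 1"
      by (auto intro: LIMSEQ_le_const[OF V_lim[OF xt]] LIMSEQ_le_const2[OF V_lim[OF xt]])
  qed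
  have u_fixed: "u x t = rhs \<psi> u x t" if xt: "x \<in> D" "t \<in> {0..<T}" for x t
  proof -
    have "(\<lambda>j. V (Suc j) x t) \<longlonglongrightarrow> rhs \<psi> u x t"
    proof (rule LIM_zero_cancel, rule Lim_null_comparison[OF always_eventually null], intro allI)
      fix j
      have "\<bar>rhs \<psi> (V j) x t - rhs \<psi> u x t\<bar> \<le> (c + 1) * (1/2) ^ j / 2 * exp (lam * t)"
        using c by (intro contract' box_V box_u u_close xt) auto
      also have "\<dots> \<le> (c + 1) * (1/2) ^ j * exp (lam * t)"
        using c by simp
      finally show "norm (V (Suc j) x t - rhs \<psi> u x t) \<le> (c + 1) * (1/2) ^ j * exp (lam * t)"
        by (simp add: V_Suc)
    qed
    then show ?thesis
      by (rule LIMSEQ_unique[OF LIMSEQ_Suc[OF V_lim[OF xt]]])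
  qed
  have "nonneg_mild_solution D p k a g \<phi> n T u"
    unfolding nonneg_mild_solution_def Linf_on_def
  proof (intro conjI exI u_meas)
    have "\<bar>case z of (t, x) \<Rightarrow> u x t\<bar> \<le> c + 1" if "z \<in> {0..<T} \<times> D" for z
      using box_u that by (auto simp: box_def)
    then show "AE z in lborel. z \<in> {0..<T} \<times> D \<longrightarrow> \<bar>case z of (t, x) \<Rightarrow> u x t\<bar> \<le> c + 1"
      by (intro AE_I2) blast
    show "AE (t, x) in lborel. (t, x) \<in> {0..<T} \<times> D \<longrightarrow> 0 \<le> u x t"
      using box_u by (intro AE_I2) (auto simp: box_def)
    \<comment> \<open>The fixed point equation holds everywhere for \<open>\<psi>\<close>, hence for \<open>\<phi>\<close> wherever the two agree.\<close>
    show "AE (t, x) in lborel. (t, x) \<in> {0..<T} \<times> D \<longrightarrow> u x t = rhs \<phi> u x t"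
      using AE_lborel_snd[OF \<psi>_eq]
    proof eventually_elim
      case (elim z)
      then show ?case
        using u_fixed rhs_cong_initial[OF \<phi>_meas \<psi>_meas \<psi>_eq]
        by (cases z) auto
    qed
  qed
  then show ?thesis using that T by blast
qed

end

section \<open>Local existence and uniqueness\<close>

theorem theorem1:
  fixes D :: "'a::euclidean_space set"
    and P :: "real \<Rightarrow> ('a \<Rightarrow> real) \<Rightarrow> 'a \<Rightarrow> real"
    and L :: "(('a \<Rightarrow> real) \<times> ('a \<Rightarrow> real)) set"
    and p :: "real \<Rightarrow> 'a \<Rightarrow> 'a \<Rightarrow> real"
    and M :: "'w measure"
    and F :: "real \<Rightarrow> 'w measure"
    and B BH I N :: "real \<Rightarrow> 'w \<Rightarrow> real"
    and H \<alpha> \<gamma> :: real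
    and a b k g :: "real \<Rightarrow> real"
    and \<phi> :: "'a \<Rightarrow> real"
  assumes "bounded_lipschitz_domain D"
    and "contraction_semigroup_L2 D P"
    and "L = L2_generator D P"
    and "continuous_transition_density D P p"
    and "filtered_prob_space M F"
    and "brownian_motion M F B"
    and "1/2 < H" and "H < 1"
    and "fractional_brownian_motion M H BH" and "adapted F BH"
    and "continuous_on {0..} a"
    and "\<alpha> > 1 - H" and "hoelder_on \<alpha> {0..} b"
    and "ito_integral M F B (\<lambda>s \<omega>. a s) I"
    and "1 - H < \<gamma>" and "\<gamma> < \<alpha>" and "\<gamma> < 1"
    and "AE \<omega> in M. \<forall>t\<ge>0. N t \<omega> = I t \<omega> + frac_integral \<gamma> b (\<lambda>s. BH s \<omega>) t"
    and "\<And>t. t \<ge> 0 \<Longrightarrow> set_integrable lborel {0..t} (\<lambda>r. (k r)\<^sup>2)"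
    and "\<And>z. 0 \<le> g z"
    and "local_lipschitz (UNIV :: real set) UNIV (\<lambda>_. g)"
    and "Linf_on D \<phi>" and "AE x in lborel. x \<in> D \<longrightarrow> 0 \<le> \<phi> x"
  shows "AE \<omega> in M. \<exists>T>0.
           (\<exists>v. nonneg_mild_solution D p k a g \<phi> (\<lambda>s. N s \<omega>) T v) \<and>
           (\<forall>v w. nonneg_mild_solution D p k a g \<phi> (\<lambda>s. N s \<omega>) T v \<longrightarrow>
                  nonneg_mild_solution D p k a g \<phi> (\<lambda>s. N s \<omega>) T w \<longrightarrow>
                  (AE (t, x) in lborel. (t, x) \<in> {0..<T} \<times> D \<longrightarrow> v x t = w x t))"
proof -
  interpret prob_space M
    using assms by (simp add: filtered_prob_space_def)
  have \<gamma>: "0 < \<gamma>"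
    using \<open>1 - H < \<gamma>\<close> \<open>H < 1\<close> by simp
  \<comment> \<open>Any order strictly between \<open>1 - \<gamma>\<close> and \<open>H\<close> would do.\<close>
  define \<beta> where "\<beta> = (1 - \<gamma> + H) / 2"
  have \<beta>: "0 < \<beta>" "\<beta> < H" "1 - \<gamma> < \<beta>"
    using \<open>1 - H < \<gamma>\<close> \<open>\<gamma> < 1\<close> \<open>1/2 < H\<close> by (auto simp: \<beta>_def field_simps)
  have "AE \<omega> in M. hoelder_on \<beta> {0..1} (\<lambda>t. BH t \<omega>)"
    using assms(9) \<beta>(1,2) by (rule fractional_brownian_paths_hoelder)
  moreover have "AE \<omega> in M. continuous_on {0..} (\<lambda>t. BH t \<omega>)"
    using assms(9) by (simp add: fractional_brownian_motion_def continuous_paths_def)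
  moreover have "AE \<omega> in M. continuous_on {0..} (\<lambda>t. I t \<omega>)"
    using assms(14) by (simp add: ito_integral_def continuous_paths_def)
  moreover note assms(18)
  ultimately show ?thesis
  proof eventually_elim
    case (elim \<omega>)
    let ?n = "\<lambda>s. N s \<omega>"
    have n: "?n t = I t \<omega> + frac_integral \<gamma> b (\<lambda>s. BH s \<omega>) t" if "0 \<le> t" for t
      using elim(4) that by blast
    have path: "set_borel_measurable lborel {0..} ?n" "\<exists>B. \<forall>t\<in>{0..1}. \<bar>?n t\<bar> \<le> B"
      by (rule noise_path_regular[OF \<gamma> \<open>\<gamma> < 1\<close> \<open>\<gamma> < \<alpha>\<close> \<beta>(3) assms(13) elim(2,1,3)]; fact n)+
    obtain \<nu> where \<nu>: "\<And>t. t \<in> {0..1} \<Longrightarrow> \<bar>?n t\<bar> \<le> \<nu>"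
      using path(2) by blast
    interpret path_equation D p k a g ?n \<nu>
    proof
      show "open D"
        using assms(1) by (simp add: bounded_lipschitz_domain_def)
      show "continuous_on ({0<..} \<times> D \<times> D) (\<lambda>(t, x, y). p t x y)"
        using assms(4) by (simp add: continuous_transition_density_def)
      show "0 \<le> p t x y" if "0 < t" "x \<in> D" "y \<in> D" for t x y
        using assms(4) that by (simp add: continuous_transition_density_def)
      show "(\<integral>\<^sup>+y\<in>D. ennreal (p t x y) \<partial>lborel) \<le> 1" if "0 < t" "x \<in> D" for t x
        using assms(4) that by (simp add: continuous_transition_density_def)
      show "set_integrable lborel {0..t} (\<lambda>r. (a r)\<^sup>2)" for t
        by (intro borel_integrable_atLeastAtMost' continuous_on_power continuous_on_subset[OF assms(11)]) auto
    qed (use assms path(1) \<nu> in blast)+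
    obtain T v where "0 < T" "T \<le> 1" "nonneg_mild_solution D p k a g \<phi> ?n T v"
      using nonneg_solution_exists[OF assms(22,23)] by blast
    then show ?case
      using nonneg_solution_unique by blast
  qed
qed

end
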